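(* Let $m>0$, $g>0$, let $n\ge 1$ be an integer, and let $$V(q)=-\frac{m}{|q|}-g\sum_{k=0}^{n}\frac{C_k}{2^{2k}}\,q_1^{2n-2k}q_2^{2k},\qquad q\in\mathbb{R}^2\setminus\{0\},$$ where $C_0=1$ and $C_k=(-1)^k-\sum_{\ell=0}^{k-1}(-1)^{k-\ell}\binom{2n-2\ell}{k-\ell}C_\ell$ for $1\le k\le n$. Suppose that the numbers $G_k=4C_k(n-k)-C_{k+1}(k+1)$ are positive for all $k=0,\dots,n-1$. Let the energy $-f$ ($f\in\mathbb{R}$) be strictly below the first critical value of $V$. Then, after Levi-Civita regularization of the energy hypersurface $\{H=-f\}$ of $H(p,q)=\frac{|p|^2}{2}+V(q)$, the corresponding bounded component of the regularized energy hypersurface $\{K=m\}$ bounds a concave toric domain.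
   Context: The first critical value of $V$ is its lowest critical value. Levi-Civita regularization: identify $\mathbb{R}^2\cong\mathbb{C}$. The shifted Hamiltonian $H+f$ and its zero level are pulled back by the map $(z,w)\mapsto (q=z^2,\ p=\frac{w}{2\bar z})$ and multiplied by $|z|^2$ (a time reparametrization). With $z=z_1+iz_2$, $w=w_1+iw_2$, the energy level $\{H=-f\}$ becomes the level $\{K=m\}$ in $\mathbb{R}^4$ (extended smoothly over $z=0$), where $$K=\frac{|w|^2}{8}+f(z_1^2+z_2^2)-g(z_1^{4n+2}+z_2^{4n+2})=K_1(z_1,w_1)+K_2(z_2,w_2),\qquad K_i=\frac{w_i^2}{8}+f z_i^2-g z_i^{4n+2} .$$ For energies below the first critical value, $\{H=-f\}$ has a component projecting to a bounded region of the configuration space, and correspondingly $\{K=m\}$ has a bounded closed component; the domain it bounds is the region around the origin enclosed by it. Action variables: for the values $a$ of $K_1$ and $b=m-a$ of $K_2$ taken on the bounded component, $0\le a\le m$, let $I_1(a)=\frac{1}{2\pi}\int_{\{K_1=a\}}w_1\,dz_1$ and $I_2(b)=\frac{1}{2\pi}\int_{\{K_2=b\}}w_2\,dz_2$ be $\frac1{2\pi}$ times the areas enclosed by the closed curves around the origin in the $(z_1,w_1)$- and $(z_2,w_2)$-planes which are the levels of $K_1$ and $K_2$ within the bounded component (with $I_i(0)=0$). The moment map image of the bounded component is the curve $\{(I_1(a),I_2(m-a)):0\le a\le m\}$ in the quadrant $\{I_1\ge 0, I_2\ge 0\}$, connecting the two axes. The bounded component is said to bound a concave toric domain if this curve is the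 graph $I_2=\varphi(I_1)$ of a smooth non-increasing convex function $\varphi$, and a convex toric domain if it is the graph of a smooth non-increasing concave function. *)

theory Defs
  imports "HOL-Analysis.Analysis"
begin

text \<open>For \<open>k \<le> n\<close> these are the coefficients with
  \<open>(x + y) * (\<Sum>k\<le>n. C k * (x - y) ^ (2*n - 2*k) * (x * y) ^ k) = x ^ (2*n + 1) + y ^ (2*n + 1)\<close>,
  which makes the regularized Hamiltonian separable; larger \<open>k\<close> are never used.\<close>

fun Ccoef :: "nat \<Rightarrow> nat \<Rightarrow> real" where
  "Ccoef n k = (if k = 0 then 1
     else (-1) ^ k - (\<Sum>l<k. (-1) ^ (k - l) * real ((2*n - 2*l) choose (k - l)) * Ccoef n l))"

declare Ccoef.simps [simp del]

definition Gcoef :: "nat \<Rightarrow> nat \<Rightarrow> real" where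
  "Gcoef n k = 4 * Ccoef n k * (real n - real k) - Ccoef n (k + 1) * (real k + 1)"

text \<open>The plane is identified with the complex numbers, and a point of phase space is a pair
  \<open>(q, p)\<close>. The value of the potential at \<open>q = 0\<close> is a junk value, so this point is excluded
  explicitly below.\<close>

definition potential :: "real \<Rightarrow> real \<Rightarrow> nat \<Rightarrow> complex \<Rightarrow> real" where
  "potential m g n q = - m / norm q
     - g * (\<Sum>k\<le>n. Ccoef n k / 2 ^ (2*k) * Re q ^ (2*n - 2*k) * Im q ^ (2*k))"

definition hamiltonian :: "(complex \<Rightarrow> real) \<Rightarrow> complex \<times> complex \<Rightarrow> real" where
  "hamiltonian V = (\<lambda>(q, p). (norm p)\<^sup>2 / 2 + V q)"

definition critical_values :: "(complex \<Rightarrow> real) \<Rightarrow> real set" where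
  "critical_values V = {V q | q. q \<noteq> 0 \<and> (V has_derivative (\<lambda>_. 0)) (at q)}"

definition is_first_critical_value :: "(complex \<Rightarrow> real) \<Rightarrow> real \<Rightarrow> bool" where
  "is_first_critical_value V c \<longleftrightarrow>
     c \<in> critical_values V \<and> (\<forall>c' \<in> critical_values V. c \<le> c')"

definition energy_surface :: "(complex \<times> complex \<Rightarrow> real) \<Rightarrow> real \<Rightarrow> (complex \<times> complex) set" where
  "energy_surface H f = {x. fst x \<noteq> 0 \<and> H x = - f}"

definition levi_civita :: "complex \<times> complex \<Rightarrow> complex \<times> complex" where
  "levi_civita = (\<lambda>(z, w). (z\<^sup>2, w / (2 * cnj z)))"

definition lc_pullback :: "(complex \<times> complex \<Rightarrow> real) \<Rightarrow> real \<Rightarrow> complex \<times> complex \<Rightarrow> real" where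
  "lc_pullback H f x = (norm (fst x))\<^sup>2 * (H (levi_civita x) + f)"

text \<open>The values over \<open>z = 0\<close> are those of the continuous extension. When \<open>H\<close> contains the
  term \<open>- m / |q|\<close>, the function below is \<open>K - m\<close>, so that its zero level is \<open>{K = m}\<close>.\<close>

definition lc_regularization :: "(complex \<times> complex \<Rightarrow> real) \<Rightarrow> real \<Rightarrow> complex \<times> complex \<Rightarrow> real" where
  "lc_regularization H f x =
     (if fst x = 0 then Lim (at x within {y. fst y \<noteq> 0}) (lc_pullback H f)
      else lc_pullback H f x)"

definition regularized_surface :: "(complex \<times> complex \<Rightarrow> real) \<Rightarrow> real \<Rightarrow> (complex \<times> complex) set" where
  "regularized_surface H f = {x. lc_regularization H f x = 0}"

text \<open>A bounded component of the regularized surface which corresponds to a component of the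
  energy surface lying over a bounded region of the configuration space. The latter component is
  itself unbounded, since the momenta blow up at the collision \<open>q = 0\<close>.\<close>

definition bounded_regularized_component ::
    "(complex \<times> complex \<Rightarrow> real) \<Rightarrow> real \<Rightarrow> (complex \<times> complex) set \<Rightarrow> bool" where
  "bounded_regularized_component H f S \<longleftrightarrow>
     S \<in> components (regularized_surface H f) \<and> bounded S \<and>
     (\<exists>E \<in> components (energy_surface H f).
        bounded (fst ` E) \<and> levi_civita ` {x \<in> S. fst x \<noteq> 0} = E)"

definition planar_hamiltonian :: "real \<Rightarrow> real \<Rightarrow> nat \<Rightarrow> real \<times> real \<Rightarrow> real" where
  "planar_hamiltonian f g n = (\<lambda>(s, t). t\<^sup>2 / 8 + f * s\<^sup>2 - g * s ^ (4*n + 2))"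

definition proj1 :: "complex \<times> complex \<Rightarrow> real \<times> real" where
  "proj1 = (\<lambda>(z, w). (Re z, Re w))"

definition proj2 :: "complex \<times> complex \<Rightarrow> real \<times> real" where
  "proj2 = (\<lambda>(z, w). (Im z, Im w))"

text \<open>The integral of \<open>w dz\<close> over a closed curve is rendered as the area enclosed by the curve.
  The parameter \<open>P\<close> is the projection to a plane of the bounded component; it selects
  the closed curve among the components of the level \<open>{k = a}\<close>.\<close>

definition action :: "(real \<times> real \<Rightarrow> real) \<Rightarrow> (real \<times> real) set \<Rightarrow> real \<Rightarrow> real" where
  "action k P a = measure lborel (inside {y \<in> P. k y = a}) / (2 * pi)"

definition moment_curve ::
    "(real \<times> real \<Rightarrow> real) \<Rightarrow> (real \<times> real \<Rightarrow> real) \<Rightarrow> real \<Rightarrow> (complex \<times> complex) set \<Rightarrow> (real \<times> real) set" where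
  "moment_curve K1 K2 m S =
     (\<lambda>a. (action K1 (proj1 ` S) a, action K2 (proj2 ` S) (m - a))) ` {0..m}"

text \<open>Derivatives of all orders, one-sided at the end points of a closed interval.\<close>

definition smooth_on :: "real set \<Rightarrow> (real \<Rightarrow> real) \<Rightarrow> bool" where
  "smooth_on T \<phi> \<longleftrightarrow> (\<exists>D :: nat \<Rightarrow> real \<Rightarrow> real.
     (\<forall>x\<in>T. D 0 x = \<phi> x) \<and>
     (\<forall>k. \<forall>x\<in>T. (D k has_real_derivative D (Suc k) x) (at x within T)))"

text \<open>The condition \<open>\<phi> A = 0\<close> says that the curve ends on the first axis; it starts on the
  second one because the graph is taken over \<open>{0..A}\<close>.\<close>

definition bounds_concave_toric_domain ::
    "(real \<times> real \<Rightarrow> real) \<Rightarrow> (real \<times> real \<Rightarrow> real) \<Rightarrow> real \<Rightarrow> (complex \<times> complex) set \<Rightarrow> bool" where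
  "bounds_concave_toric_domain K1 K2 m S \<longleftrightarrow>
     0 \<in> inside S \<and>
     (\<exists>A \<phi>. 0 < A \<and> \<phi> A = 0 \<and>
        moment_curve K1 K2 m S = {(x, \<phi> x) | x. x \<in> {0..A}} \<and>
        smooth_on {0..A} \<phi> \<and> antimono_on {0..A} \<phi> \<and> convex_on {0..A} \<phi>)"

end

theory Submission
  imports Defs
begin

text \<open>
Put \<open>U \<rho> = f * \<rho> - g * \<rho> ^ (2*n + 1)\<close>, so that the planar Hamiltonian is
\<open>K (s, t) = t\<^sup>2 / 8 + U (s\<^sup>2)\<close>. With \<open>X = (Re z)\<^sup>2\<close> and \<open>Y = (Im z)\<^sup>2\<close> the substitution \<open>q = z\<^sup>2\<close>
turns the polynomial part of the potential into
\<open>\<Sum>k\<le>n. C k * (X - Y) ^ (2*n - 2*k) * (X * Y) ^ k\<close>, and the recursion for the \<open>C k\<close> says that \<open>X + Y\<close>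
times this sum is \<open>X ^ (2*n + 1) + Y ^ (2*n + 1)\<close> (\<open>Ccoef_separation\<close>). So the regularized surface is
the level \<open>m\<close> of the sum of two copies of \<open>K\<close> (\<open>lc_regularization_separated\<close>).

The potential has a critical point on the positive real axis. An energy \<open>- f\<close> below the first
critical value is below the value there, which means that \<open>U\<close> exceeds \<open>m\<close> somewhere
(\<open>well_exceeds_below_first_critical_value\<close>). Hence \<open>U\<close> increases from \<open>0\<close> to a peak higher than
\<open>m\<close> at some \<open>\<rho>c\<close>, takes the value \<open>m\<close> at a turning point \<open>\<rho>m < \<rho>c\<close>, and decreases after \<open>\<rho>c\<close>.

The points of the level with \<open>X \<le> \<rho>m\<close> and \<open>Y \<le> \<rho>m\<close> form a three-sphere which is open and closed
in the level, and the energy barrier at \<open>\<rho>c\<close> separates it from the rest. At any other point one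
coordinate lies beyond the peak and can move to infinity along its level of \<open>K\<close>, so that no other
component is bounded. The Levi-Civita map sends the sphere without its collision circle \<open>z = 0\<close> onto a
component of the energy surface over a bounded region, since that part is still connected
(\<open>bounded_regularized_component_iff\<close>).

For the moment curve let \<open>R\<close> be the inverse of \<open>U\<close> on \<open>{0..m}\<close>. Slicing the region enclosed at energy
\<open>a\<close> along lines of constant momentum gives the area as the integral of
\<open>2 * sqrt (R (a - t\<^sup>2 / 8))\<close> over \<open>t\<close>. Here \<open>sqrt (R y) = sqrt y * q y\<close> with
\<open>q = (f - g * R ^ (2*n)) powr (- 1/2)\<close>, and rescaling \<open>t\<close> yields the action
\<open>I a = sqrt 8 / pi * a * integral {-1..1} (\<lambda>x. sqrt (1 - x\<^sup>2) * q (a * (1 - x\<^sup>2)))\<close>, which is smooth up to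
both ends of \<open>{0..m}\<close>. Since the well softens with growing amplitude, \<open>q\<close> and its derivative are
nonnegative and increasing; so \<open>I'\<close> is positive and increasing. The curve of the pairs
\<open>(I a, I (m - a))\<close> is then a graph with slope \<open>- I' (m - a) / I' a\<close>, which increases with \<open>a\<close>
(\<open>convex_graph_of_reflected_pair\<close>).
\<close>

section \<open>Separation of variables\<close>

lemma sum_Ccoef_binomial:
  assumes "j \<le> n"
  shows "(\<Sum>l\<le>j. (-1) ^ (j - l) * real ((2*n - 2*l) choose (j - l)) * Ccoef n l) = (-1) ^ j"
proof -
  have "(\<Sum>l\<le>j. (-1) ^ (j - l) * real ((2*n - 2*l) choose (j - l)) * Ccoef n l)
      = (\<Sum>l<j. (-1) ^ (j - l) * real ((2*n - 2*l) choose (j - l)) * Ccoef n l) + Ccoef n j"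
    by (simp add: lessThan_Suc_atMost [symmetric])
  also have "\<dots> = (-1) ^ j"
    by (subst (2) Ccoef.simps) auto
  finally show ?thesis .
qed

text \<open>The left-hand side is the coefficient of \<open>x ^ (2*n - j) * y ^ j\<close> in
\<open>\<Sum>k\<le>n. C k * (x - y) ^ (2*n - 2*k) * (x * y) ^ k\<close>. The recursion for the \<open>C k\<close> settles it for
\<open>j \<le> n\<close>. The polynomial is symmetric in \<open>x\<close> and \<open>y\<close>, which reduces the other \<open>j\<close> to
\<open>i = 2*n - j\<close>.\<close>

lemma sum_Ccoef_monomial:
  assumes "j \<le> 2*n"
  shows "(\<Sum>k\<le>n. if k \<le> j then (-1) ^ (j - k) * real ((2*n - 2*k) choose (j - k)) * Ccoef n k else 0)
    = (-1) ^ j" (is "?L = _")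
proof -
  \<comment> \<open>The reflection of j into the range up to n, which has the same parity.\<close>
  define i where "i = min j (2*n - j)"
  have i: "i \<le> n" "(-1) ^ i = ((-1) ^ j :: real)"
    using assms by (auto simp: i_def min_def minus_one_power_iff)
  have "?L = (\<Sum>k\<le>n. if k \<le> i then (-1) ^ (i - k) * real ((2*n - 2*k) choose (i - k)) * Ccoef n k else 0)"
  proof (rule sum.cong [OF refl])
    fix k assume k: "k \<in> {..n}"
    show "(if k \<le> j then (-1) ^ (j - k) * real ((2*n - 2*k) choose (j - k)) * Ccoef n k else 0)
      = (if k \<le> i then (-1) ^ (i - k) * real ((2*n - 2*k) choose (i - k)) * Ccoef n k else 0)"
    proof (cases "j \<le> n")
      case True
      then have "i = j" by (auto simp: i_def)
      then show ?thesis by simp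
    next
      case False
      then have ij: "i = 2*n - j" "k \<le> j" using k by (auto simp: i_def)
      show ?thesis
      proof (cases "k \<le> i")
        case True
        have "(2*n - 2*k) choose (j - k) = (2*n - 2*k) choose (i - k)"
          using binomial_symmetric [of "j - k" "2*n - 2*k"] True ij assms
          by (simp add: algebra_simps)
        moreover have "(-1) ^ (j - k) = ((-1) ^ (i - k) :: real)"
          using True ij assms by (auto simp: minus_one_power_iff)
        ultimately show ?thesis using True ij by simp
      next
        case f: False
        have "(2*n - 2*k) choose (j - k) = 0"
          using f ij assms k by (intro binomial_eq_0) auto
        then show ?thesis using f by simp
      qed
    qed
  qed
  also have "\<dots> = (\<Sum>k\<in>{..n} \<inter> {k. k \<le> i}. (-1) ^ (i - k) * real ((2*n - 2*k) choose (i - k)) * Ccoef n k)"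
    by (subst sum.inter_restrict) (auto intro!: sum.cong)
  also have "{..n} \<inter> {k. k \<le> i} = {..i}"
    using i by auto
  finally show ?thesis
    using sum_Ccoef_binomial [OF i(1)] i(2) by simp
qed

lemma alternating_geometric_sum:
  fixes x y :: real
  shows "(x + y) * (\<Sum>j\<le>2*n. (-1) ^ j * x ^ (2*n - j) * y ^ j) = x ^ (2*n + 1) + y ^ (2*n + 1)"
proof -
  have "(x + y) * (\<Sum>j\<le>2*n. (-1) ^ j * x ^ (2*n - j) * y ^ j)
      = - ((- y - x) * (\<Sum>j<Suc (2*n). x ^ (Suc (2*n) - Suc j) * (- y) ^ j))"
    by (simp add: lessThan_Suc_atMost algebra_simps power_minus [of y])
  also have "\<dots> = - ((- y) ^ Suc (2*n) - x ^ Suc (2*n))"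
    by (subst power_diff_sumr2) simp
  finally show ?thesis by simp
qed

text \<open>The sum over \<open>k\<close> equals the alternating sum of the monomials of degree \<open>2*n\<close>, which the
factor \<open>x + y\<close> makes telescope.\<close>

lemma Ccoef_separation:
  fixes x y :: real
  shows "(x + y) * (\<Sum>k\<le>n. Ccoef n k * (x - y) ^ (2*n - 2*k) * (x * y) ^ k)
    = x ^ (2*n + 1) + y ^ (2*n + 1)"
proof -
  have "(\<Sum>k\<le>n. Ccoef n k * (x - y) ^ (2*n - 2*k) * (x * y) ^ k)
     = (\<Sum>k\<le>n. \<Sum>j\<le>2*n. (if k \<le> j then (-1) ^ (j - k) * real ((2*n - 2*k) choose (j - k)) * Ccoef n k
          else 0) * (x ^ (2*n - j) * y ^ j))" 
  proof (rule sum.cong [OF refl])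
    fix k assume k: "k \<in> {..n}"
    let ?N = "2*n - 2*k"
    let ?c = "\<lambda>j. (if k \<le> j then (-1) ^ (j - k) * real (?N choose (j - k)) * Ccoef n k else 0)
        * (x ^ (2*n - j) * y ^ j)"
    have "Ccoef n k * (x - y) ^ ?N * (x * y) ^ k
       = (\<Sum>i\<le>?N. Ccoef n k * (real (?N choose i) * (- y) ^ i * x ^ (?N - i)) * (x * y) ^ k)"
      using binomial_ring [of "- y" x ?N]
      by (simp add: sum_distrib_left sum_distrib_right)
    also have "\<dots> = (\<Sum>i\<le>?N. ?c (i + k))"
    proof (rule sum.cong [OF refl])
      fix i assume i: "i \<in> {..?N}"
      then have "2*n - (i + k) = (?N - i) + k" using k by auto
      then show "Ccoef n k * (real (?N choose i) * (- y) ^ i * x ^ (?N - i)) * (x * y) ^ k = ?c (i + k)"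
        by (simp add: power_add power_mult_distrib power_minus [of y] algebra_simps)
    qed
    also have "\<dots> = (\<Sum>j\<in>{k..?N + k}. ?c j)"
      by (rule sum.reindex_bij_witness [of _ "\<lambda>j. j - k" "\<lambda>i. i + k"]) auto
    also have "\<dots> = (\<Sum>j\<le>2*n. ?c j)"
      using k by (intro sum.mono_neutral_left) (auto simp: binomial_eq_0)
    finally show "Ccoef n k * (x - y) ^ ?N * (x * y) ^ k = (\<Sum>j\<le>2*n. ?c j)" .
  qed
  also have "\<dots> = (\<Sum>j\<le>2*n. (-1) ^ j * x ^ (2*n - j) * y ^ j)"
    by (subst sum.swap)
       (auto simp: sum_distrib_right [symmetric] sum_Ccoef_monomial mult.assoc intro!: sum.cong)
  finally show ?thesis
    by (simp only: alternating_geometric_sum)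
qed

section \<open>Smooth functions on a set of reals\<close>

text \<open>A class of functions that is closed under taking derivatives consists of smooth functions:
iterate a choice of derivative inside the class. The smoothness proofs below rest on such classes,
so that no formula for a higher derivative is needed.\<close>

lemma smooth_on_coinduct:
  assumes "F \<in> C"
    and step: "\<And>G. G \<in> C \<Longrightarrow> \<exists>G'\<in>C. \<forall>x\<in>T. (G has_real_derivative G' x) (at x within T)"
  shows "smooth_on T F"
proof -
  obtain d where d: "\<And>G. G \<in> C \<Longrightarrow> d G \<in> C \<and> (\<forall>x\<in>T. (G has_real_derivative d G x) (at x within T))"
    using step by metis
  have "(d ^^ k) F \<in> C" for k
    using assms(1) d by (induction k) auto
  then show ?thesis
    unfolding smooth_on_def using d by (intro exI [of _ "\<lambda>k. (d ^^ k) F"]) auto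
qed

lemma smooth_onE:
  assumes "smooth_on T F"
  obtains F' where "smooth_on T F'" "\<And>x. x \<in> T \<Longrightarrow> (F has_real_derivative F' x) (at x within T)"
proof -
  obtain D where D: "\<forall>x\<in>T. D 0 x = F x"
    "\<And>k x. x \<in> T \<Longrightarrow> (D k has_real_derivative D (Suc k) x) (at x within T)"
    using assms unfolding smooth_on_def by blast
  have "smooth_on T (D 1)"
    unfolding smooth_on_def using D by (intro exI [of _ "\<lambda>k. D (Suc k)"]) auto
  moreover have "(F has_real_derivative D 1 x) (at x within T)" if "x \<in> T" for x
    using has_derivative_transform [OF that, of F "D 0"] D(2) [OF that, of 0] D(1)
    unfolding has_field_derivative_def by simp
  ultimately show ?thesis using that by blast
qed

lemma smooth_on_cong:
  assumes "smooth_on T F" "\<And>x. x \<in> T \<Longrightarrow> G x = F x"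
  shows "smooth_on T G"
  using assms by (simp add: smooth_on_def)

lemma smooth_on_imp_continuous_on:
  assumes "smooth_on T F"
  shows "continuous_on T F"
  using smooth_onE [OF assms] DERIV_continuous_on by metis

text \<open>Neither the products nor the powers of smooth functions form a class closed under derivatives; the
expressions built from smooth functions by all of these operations do.\<close>

inductive smooth_expr :: "real set \<Rightarrow> (real \<Rightarrow> real) \<Rightarrow> bool" for T where
  gen: "smooth_on T F \<Longrightarrow> smooth_expr T F"
| add: "smooth_expr T F \<Longrightarrow> smooth_expr T G \<Longrightarrow> smooth_expr T (\<lambda>x. F x + G x)"
| mult: "smooth_expr T F \<Longrightarrow> smooth_expr T G \<Longrightarrow> smooth_expr T (\<lambda>x. F x * G x)"
| powr: "smooth_expr T F \<Longrightarrow> (\<And>x. x \<in> T \<Longrightarrow> F x > 0) \<Longrightarrow> smooth_expr T (\<lambda>x. F x powr r)"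

lemma smooth_on_affine: "smooth_on T (\<lambda>x. a * x + b)"
proof (rule smooth_on_coinduct)
  show "(\<lambda>x. a * x + b) \<in> {\<lambda>x. a * x + b | a b. True}" by blast
next
  fix G :: "real \<Rightarrow> real" assume "G \<in> {\<lambda>x. a * x + b | a b. True}"
  then obtain a b where G: "G = (\<lambda>x. a * x + b)" by blast
  \<comment> \<open>The derivative is constant, hence again affine.\<close>
  have "(\<lambda>x::real. a) = (\<lambda>x. 0 * x + a)" by simp
  then have "(\<lambda>x. a) \<in> {\<lambda>x. a * x + b | a b. True}" by blast
  moreover have "(G has_real_derivative a) (at x within T)" for x
    unfolding G by (auto intro!: derivative_eq_intros)
  ultimately show "\<exists>G'\<in>{\<lambda>x. a * x + b | a b. True}. \<forall>x\<in>T. (G has_real_derivative G' x) (at x within T)"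
    by (intro bexI [of _ "\<lambda>x. a"]) auto
qed

lemma smooth_on_const: "smooth_on T (\<lambda>x. b)"
  using smooth_on_affine [of T 0 b] by simp

lemma smooth_on_ident: "smooth_on T (\<lambda>x. x)"
  using smooth_on_affine [of T 1 0] by simp

lemma smooth_expr_derivative:
  assumes "smooth_expr T F"
  shows "\<exists>F'. smooth_expr T F' \<and> (\<forall>x\<in>T. (F has_real_derivative F' x) (at x within T))"
  using assms
proof induction
  case (gen F)
  then show ?case by (metis smooth_expr.gen smooth_onE)
next
  case (add F G)
  then obtain F' G' where "smooth_expr T F'" "\<forall>x\<in>T. (F has_real_derivative F' x) (at x within T)"
    "smooth_expr T G'" "\<forall>x\<in>T. (G has_real_derivative G' x) (at x within T)" by blast
  then show ?case
    by (intro exI [of _ "\<lambda>x. F' x + G' x"]) (auto intro: smooth_expr.add derivative_intros)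
next
  case (mult F G)
  then obtain F' G' where "smooth_expr T F'" "\<forall>x\<in>T. (F has_real_derivative F' x) (at x within T)"
    "smooth_expr T G'" "\<forall>x\<in>T. (G has_real_derivative G' x) (at x within T)" by blast
  with mult show ?case
    by (intro exI [of _ "\<lambda>x. F' x * G x + G' x * F x"])
       (auto intro!: smooth_expr.add smooth_expr.mult DERIV_mult)
next
  case (powr F r)
  then obtain F' where F': "smooth_expr T F'" "\<forall>x\<in>T. (F has_real_derivative F' x) (at x within T)"
    by blast
  have "((\<lambda>x. F x powr r) has_real_derivative (r * F x powr (r - 1)) * F' x) (at x within T)"
    if "x \<in> T" for x
    using that powr F' by (intro DERIV_chain2 [OF has_real_derivative_powr]) auto
  moreover have "smooth_expr T (\<lambda>x. (r * F x powr (r - 1)) * F' x)"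
    using powr F' by (intro smooth_expr.mult smooth_expr.powr smooth_expr.gen [OF smooth_on_const]) auto
  ultimately show ?case by blast
qed

lemma smooth_on_smooth_expr:
  assumes "smooth_expr T F"
  shows "smooth_on T F"
  by (rule smooth_on_coinduct [where C = "Collect (smooth_expr T)"])
     (use assms smooth_expr_derivative in auto)

lemma smooth_on_add: "smooth_on T F \<Longrightarrow> smooth_on T G \<Longrightarrow> smooth_on T (\<lambda>x. F x + G x)"
  and smooth_on_mult: "smooth_on T F \<Longrightarrow> smooth_on T G \<Longrightarrow> smooth_on T (\<lambda>x. F x * G x)"
  and smooth_on_powr:
    "smooth_on T F \<Longrightarrow> (\<And>x. x \<in> T \<Longrightarrow> F x > 0) \<Longrightarrow> smooth_on T (\<lambda>x. F x powr r)"
    apply (rule smooth_on_smooth_expr, erule (1) smooth_expr.add [OF smooth_expr.gen smooth_expr.gen])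
   apply (rule smooth_on_smooth_expr, erule (1) smooth_expr.mult [OF smooth_expr.gen smooth_expr.gen])
  apply (rule smooth_on_smooth_expr, rule smooth_expr.powr, erule smooth_expr.gen, assumption)
  done

lemma smooth_on_diff:
  assumes "smooth_on T F" "smooth_on T G"
  shows "smooth_on T (\<lambda>x. F x - G x)"
  using smooth_on_add [OF assms(1) smooth_on_mult [OF smooth_on_const [of T "-1"] assms(2)]] by simp

lemma smooth_on_divide:
  assumes "smooth_on T F" "smooth_on T G" "\<And>x. x \<in> T \<Longrightarrow> G x > 0"
  shows "smooth_on T (\<lambda>x. F x / G x)"
proof (rule smooth_on_cong [OF smooth_on_mult [OF assms(1) smooth_on_powr [OF assms(2,3), of "-1"]]])
  fix x assume "x \<in> T"
  then show "F x / G x = F x * G x powr - 1"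
    using assms(3) [of x] by (simp add: powr_minus_divide)
qed

lemma smooth_on_power: "smooth_on T F \<Longrightarrow> smooth_on T (\<lambda>x. F x ^ k)"
  by (induction k) (simp_all add: smooth_on_const smooth_on_mult)

text \<open>If \<open>R\<close> solves the differential equation \<open>R' = W(R)\<close>, then the derivative of \<open>P \<circ> R\<close> is
\<open>(P' * W) \<circ> R\<close>, so that the functions \<open>P \<circ> R\<close> with \<open>P\<close> smooth form a class closed under
derivatives. An inverse function solves such an equation, with \<open>W = 1 / F'\<close>; this covers the inverse
function theorem for smooth functions, one-sided at the end points.\<close>

lemma smooth_on_compose_autonomous:
  assumes R: "\<And>y. y \<in> T \<Longrightarrow> R y \<in> S"
    and R': "\<And>y. y \<in> T \<Longrightarrow> (R has_real_derivative W (R y)) (at y within T)"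
    and "smooth_on S P" "smooth_on S W"
  shows "smooth_on T (\<lambda>y. P (R y))"
proof (rule smooth_on_coinduct)
  show "(\<lambda>y. P (R y)) \<in> {\<lambda>y. P (R y) | P. smooth_on S P}" using assms(3) by blast
next
  fix G assume "G \<in> {\<lambda>y. P (R y) | P. smooth_on S P}"
  then obtain P where G: "G = (\<lambda>y. P (R y))" and P: "smooth_on S P" by blast
  obtain P' where P': "smooth_on S P'" "\<And>x. x \<in> S \<Longrightarrow> (P has_real_derivative P' x) (at x within S)"
    using smooth_onE [OF P] by metis
  have "(G has_real_derivative P' (R y) * W (R y)) (at y within T)" if "y \<in> T" for y
    using DERIV_image_chain [OF has_field_derivative_subset [OF P'(2) [OF R [OF that]]] R' [OF that]] R
    by (auto simp: G o_def)
  moreover have "smooth_on S (\<lambda>x. P' x * W x)" using P'(1) assms(4) by (rule smooth_on_mult)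
  ultimately show "\<exists>G'\<in>{\<lambda>y. P (R y) | P. smooth_on S P}.
      \<forall>x\<in>T. (G has_real_derivative G' x) (at x within T)"
    by (intro bexI [of _ "\<lambda>y. P' (R y) * W (R y)"] ballI CollectI exI [of _ "\<lambda>x. P' x * W x"]) auto
qed

lemma smooth_on_reflect:
  assumes "smooth_on {0..m} P"
  shows "smooth_on {0..m} (\<lambda>a. P (m - a))"
  by (rule smooth_on_compose_autonomous [OF _ _ assms smooth_on_const [of _ "-1"]])
     (auto intro!: derivative_eq_intros)

section \<open>Inverse functions and convexity on an interval\<close>

lemma mean_value_within:
  fixes F F' :: "real \<Rightarrow> real"
  assumes der: "\<And>x. x \<in> {a..b} \<Longrightarrow> (F has_real_derivative F' x) (at x within {a..b})"
    and xy: "x \<in> {a..b}" "y \<in> {a..b}" "x < y"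
  obtains z where "x < z" "z < y" "F y - F x = F' z * (y - x)"
proof (rule mvt [OF xy(3), of F "\<lambda>z h. F' z * h"])
  show "continuous_on {x..y} F"
    by (rule continuous_on_subset [OF DERIV_continuous_on [OF der]]) (use xy in auto)
  show "(F has_derivative (*) (F' z)) (at z)" if "x < z" "z < y" for z
  proof -
    have "at z within {a..b} = at z" by (rule at_within_interior) (use that xy in auto)
    then show ?thesis using der [of z] that xy by (simp add: has_field_derivative_def)
  qed
qed (use that in auto)

lemma inverse_on_interval:
  fixes F F' :: "real \<Rightarrow> real"
  assumes "a < b"
    and der: "\<And>x. x \<in> {a..b} \<Longrightarrow> (F has_real_derivative F' x) (at x within {a..b})"
    and pos: "\<And>x. x \<in> {a..b} \<Longrightarrow> F' x > 0"
  defines "R \<equiv> the_inv_into {a..b} F"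
  shows "strict_mono_on {a..b} F" "F ` {a..b} = {F a..F b}"
    "\<And>x. x \<in> {a..b} \<Longrightarrow> R (F x) = x" "R ` {F a..F b} = {a..b}"
    "\<And>y. y \<in> {F a..F b} \<Longrightarrow> F (R y) = y"
    "strict_mono_on {F a..F b} R"
    "\<And>y. y \<in> {F a..F b} \<Longrightarrow> (R has_real_derivative 1 / F' (R y)) (at y within {F a..F b})"
proof -
  have cont: "continuous_on {a..b} F" using der by (rule DERIV_continuous_on)
  have mono: "strict_mono_on {a..b} F"
  proof (rule strict_mono_onI)
    fix x y assume xy: "x \<in> {a..b}" "y \<in> {a..b}" "x < y"
    obtain z where z: "x < z" "z < y" "F y - F x = F' z * (y - x)"
      using mean_value_within [OF der xy] .
    moreover have "F' z > 0" using z xy by (intro pos) auto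
    ultimately have "F y - F x > 0" using xy by simp
    then show "F x < F y" by simp
  qed
  have inj: "inj_on F {a..b}" using mono by (rule strict_mono_on_imp_inj_on)
  have img: "F ` {a..b} = {F a..F b}"
  proof
    show "F ` {a..b} \<subseteq> {F a..F b}"
      using mono_onD [OF strict_mono_on_imp_mono_on [OF mono]] by force
    show "{F a..F b} \<subseteq> F ` {a..b}"
      using IVT' [of F a _ b] \<open>a < b\<close> cont by fastforce
  qed
  have RF: "R (F x) = x" if "x \<in> {a..b}" for x
    using the_inv_into_f_f [OF inj that] by (simp add: R_def)
  have FR: "F (R y) = y \<and> R y \<in> {a..b}" if "y \<in> {F a..F b}" for y
    using that RF unfolding img [symmetric] by auto
  have Rimg: "R ` {F a..F b} = {a..b}"
    unfolding img [symmetric] image_image using RF by auto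
  have contR: "continuous_on (F ` {a..b}) R"
    using continuous_on_inv [OF cont] RF by auto
  have derR: "(R has_real_derivative 1 / F' (R y)) (at y within {F a..F b})" if "y \<in> {F a..F b}" for y
  proof -
    have Ry: "R y \<in> {a..b}" "F (R y) = y" using FR that by auto
    have "(R has_derivative (\<lambda>h. h / F' (R y))) (at (F (R y)) within F ` {a..b})"
    proof (rule has_derivative_inverse_within)
      show "(F has_derivative (*) (F' (R y))) (at (R y) within {a..b})"
        using der [OF Ry(1)] by (simp add: has_field_derivative_def)
      show "continuous (at (F (R y)) within F ` {a..b}) R"
        using contR Ry(1) by (auto simp: continuous_on_eq_continuous_within)
      show "linear (\<lambda>h. h / F' (R y))"
        by (intro linearI) (auto simp: add_divide_distrib)
    qed (use Ry RF pos [OF Ry(1)] in \<open>auto simp: fun_eq_iff\<close>)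
    moreover have "(\<lambda>h. h / F' (R y)) = (*) (1 / F' (R y))"
      by (auto simp: fun_eq_iff)
    ultimately show ?thesis
      by (simp add: has_field_derivative_def Ry img)
  qed
  have monoR: "strict_mono_on {F a..F b} R"
  proof (rule strict_mono_onI, rule ccontr)
    fix x y assume xy: "x \<in> {F a..F b}" "y \<in> {F a..F b}" "x < y" "\<not> R x < R y"
    then have "F (R y) \<le> F (R x)"
      using mono_onD [OF strict_mono_on_imp_mono_on [OF mono], of "R y" "R x"] FR by auto
    then show False using FR xy by auto
  qed
  show "strict_mono_on {a..b} F" "F ` {a..b} = {F a..F b}" "R ` {F a..F b} = {a..b}"
    "strict_mono_on {F a..F b} R"
    using mono img Rimg monoR by auto
  show "R (F x) = x" if "x \<in> {a..b}" for x
    using that by (rule RF)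
  show "F (R y) = y" if "y \<in> {F a..F b}" for y
    using FR that by blast
  show "(R has_real_derivative 1 / F' (R y)) (at y within {F a..F b})" if "y \<in> {F a..F b}" for y
    using that by (rule derR)
qed

text \<open>The graph lies above its tangents by the mean value theorem. The derivatives are one-sided at the
end points, so that convexity holds on the closed interval.\<close>

lemma convex_on_derivative_mono:
  fixes F F' :: "real \<Rightarrow> real"
  assumes der: "\<And>x. x \<in> {a..b} \<Longrightarrow> (F has_real_derivative F' x) (at x within {a..b})"
    and mono: "\<And>x y. a \<le> x \<Longrightarrow> x \<le> y \<Longrightarrow> y \<le> b \<Longrightarrow> F' x \<le> F' y"
  shows "convex_on {a..b} F"
proof (rule convex_onI)
  have tangent: "F y \<ge> F x + F' x * (y - x)" if xy: "x \<in> {a..b}" "y \<in> {a..b}" for x y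
  proof (cases x y rule: linorder_cases)
    case less
    obtain z where z: "x < z" "z < y" "F y - F x = F' z * (y - x)"
      using mean_value_within [OF der xy less] .
    have "F' x * (y - x) \<le> F' z * (y - x)"
      using mono [of x z] z xy by (intro mult_right_mono) auto
    with z(3) show ?thesis by linarith
  next
    case greater
    obtain z where z: "y < z" "z < x" "F x - F y = F' z * (x - y)"
      using mean_value_within [OF der xy(2,1) greater] .
    have "F' z * (x - y) \<le> F' x * (x - y)"
      using mono [of z x] z xy by (intro mult_right_mono) auto
    with z(3) show ?thesis by (simp add: algebra_simps)
  qed simp
  fix t x y :: real
  assume t: "0 < t" "t < 1" and xy: "x \<in> {a..b}" "y \<in> {a..b}"
  define z where "z = (1 - t) *\<^sub>R x + t *\<^sub>R y"
  have z: "z \<in> {a..b}"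
    unfolding z_def using convexD_alt [OF convex_real_interval(5) xy, of t] t by auto
  have "(1 - t) * (F z + F' z * (x - z)) + t * (F z + F' z * (y - z)) \<le> (1 - t) * F x + t * F y"
    using tangent [OF z xy(1)] tangent [OF z xy(2)] t by (intro add_mono mult_left_mono) auto
  moreover have "(1 - t) * (F z + F' z * (x - z)) + t * (F z + F' z * (y - z)) = F z"
    by (simp add: z_def algebra_simps)
  ultimately show "F ((1 - t) *\<^sub>R x + t *\<^sub>R y) \<le> (1 - t) * F x + t * F y"
    by (simp add: z_def)
qed (rule convex_real_interval)

section \<open>Integrals depending on a parameter\<close>

lemma semicircle_argument:
  fixes a x :: real
  assumes "a \<in> {0..m}" "x \<in> {-1..1}"
  shows "a * (1 - x\<^sup>2) \<in> {0..m}"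
proof -
  have "x\<^sup>2 \<le> 1" using assms(2) by (auto simp: abs_square_le_1)
  then show ?thesis
    using assms(1) mult_left_le [of "1 - x\<^sup>2" a] by auto
qed

text \<open>Differentiation under the integral sign. The derivative has the same form, with weight
\<open>w x * (1 - x\<^sup>2)\<close> and with \<open>G'\<close> in place of \<open>G\<close>, so that such averages form a class closed under
derivatives.\<close>

lemma weighted_average_derivative:
  fixes w G G' :: "real \<Rightarrow> real"
  assumes w: "continuous_on {-1..1} w"
    and G: "\<And>y. y \<in> {0..m} \<Longrightarrow> (G has_real_derivative G' y) (at y within {0..m})"
    and G': "continuous_on {0..m} G'"
    and a: "a \<in> {0..m}"
  shows "((\<lambda>a. integral {-1..1} (\<lambda>x. w x * G (a * (1 - x\<^sup>2)))) has_real_derivative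
      integral {-1..1} (\<lambda>x. w x * (1 - x\<^sup>2) * G' (a * (1 - x\<^sup>2)))) (at a within {0..m})"
proof -
  note range = semicircle_argument
  have contG: "continuous_on {0..m} G" using G by (rule DERIV_continuous_on)
  have "((\<lambda>a. integral (cbox (-1) 1) (\<lambda>x. w x * G (a * (1 - x\<^sup>2)))) has_field_derivative
      integral (cbox (-1) 1) (\<lambda>x. w x * (1 - x\<^sup>2) * G' (a * (1 - x\<^sup>2)))) (at a within {0..m})"
  proof (rule leibniz_rule_field_derivative)
    fix a x :: real assume a: "a \<in> {0..m}" and "x \<in> cbox (-1) 1"
    then have x: "x \<in> {-1..1}" by simp
    have "(G has_real_derivative G' (a * (1 - x\<^sup>2)))
        (at (a * (1 - x\<^sup>2)) within (\<lambda>a. a * (1 - x\<^sup>2)) ` {0..m})"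
      by (rule has_field_derivative_subset [OF G]) (use range a x in auto)
    then have "((\<lambda>a. G (a * (1 - x\<^sup>2))) has_real_derivative G' (a * (1 - x\<^sup>2)) * (1 - x\<^sup>2))
        (at a within {0..m})"
      by (rule DERIV_image_chain [unfolded o_def]) (auto intro!: derivative_eq_intros)
    then show "((\<lambda>a. w x * G (a * (1 - x\<^sup>2))) has_field_derivative
        w x * (1 - x\<^sup>2) * G' (a * (1 - x\<^sup>2))) (at a within {0..m})"
      by (auto intro!: derivative_eq_intros)
  next
    fix a :: real assume "a \<in> {0..m}"
    then have "continuous_on {-1..1} (\<lambda>x. w x * G (a * (1 - x\<^sup>2)))"
      by (intro continuous_intros w continuous_on_compose2 [OF contG]) (use range in auto)
    then show "(\<lambda>x. w x * G (a * (1 - x\<^sup>2))) integrable_on cbox (-1) 1"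
      using integrable_continuous_real by auto
  next
    show "continuous_on ({0..m} \<times> cbox (-1) 1) (\<lambda>(a, x). w x * (1 - x\<^sup>2) * G' (a * (1 - x\<^sup>2)))"
      unfolding split_beta
      by (intro continuous_intros continuous_on_compose2 [OF G'] continuous_on_compose2 [OF w])
         (use range in auto)
  qed (use a in auto)
  then show ?thesis by simp
qed

lemma smooth_on_weighted_average:
  assumes w: "continuous_on {-1..1} w" and G: "smooth_on {0..m} G"
  shows "smooth_on {0..m} (\<lambda>a. integral {-1..1} (\<lambda>x. w x * G (a * (1 - x\<^sup>2))))"
proof (rule smooth_on_coinduct)
  let ?C = "{\<lambda>a. integral {-1..1} (\<lambda>x. w x * G (a * (1 - x\<^sup>2))) | w G.
    continuous_on {-1..1} w \<and> smooth_on {0..m} G}"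
  show "(\<lambda>a. integral {-1..1} (\<lambda>x. w x * G (a * (1 - x\<^sup>2)))) \<in> ?C" using assms by blast
  fix F assume "F \<in> ?C"
  then obtain w G where F: "F = (\<lambda>a. integral {-1..1} (\<lambda>x. w x * G (a * (1 - x\<^sup>2))))"
    and w: "continuous_on {-1..1} w" and "smooth_on {0..m} G" by blast
  then obtain G' where G': "smooth_on {0..m} G'"
    "\<And>y. y \<in> {0..m} \<Longrightarrow> (G has_real_derivative G' y) (at y within {0..m})"
    using smooth_onE by metis
  show "\<exists>F'\<in>?C. \<forall>a\<in>{0..m}. (F has_real_derivative F' a) (at a within {0..m})"
  proof (intro bexI ballI)
    fix a :: real assume "a \<in> {0..m}"
    then show "(F has_real_derivative integral {-1..1} (\<lambda>x. (w x * (1 - x\<^sup>2)) * G' (a * (1 - x\<^sup>2))))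
        (at a within {0..m})"
      unfolding F
      by (intro weighted_average_derivative w G' smooth_on_imp_continuous_on)
  next
    have "continuous_on {-1..1} (\<lambda>x. w x * (1 - x\<^sup>2))"
      by (intro continuous_intros w)
    then show "(\<lambda>a. integral {-1..1} (\<lambda>x. (w x * (1 - x\<^sup>2)) * G' (a * (1 - x\<^sup>2)))) \<in> ?C"
      using G'(1) by (intro CollectI exI [of _ "\<lambda>x. w x * (1 - x\<^sup>2)"] exI [of _ G']) auto
  qed
qed

lemma weighted_average_mono:
  fixes w G :: "real \<Rightarrow> real"
  assumes w: "continuous_on {-1..1} w" "\<And>x. x \<in> {-1..1} \<Longrightarrow> 0 \<le> w x"
    and G: "continuous_on {0..m} G" "mono_on {0..m} G"
    and ab: "0 \<le> a" "a \<le> b" "b \<le> m"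
  shows "integral {-1..1} (\<lambda>x. w x * G (a * (1 - x\<^sup>2)))
    \<le> integral {-1..1} (\<lambda>x. w x * G (b * (1 - x\<^sup>2)))"
proof (rule integral_le)
  note range = semicircle_argument
  have "(\<lambda>x. w x * G (c * (1 - x\<^sup>2))) integrable_on {-1..1}" if "c \<in> {0..m}" for c
    by (intro integrable_continuous_real continuous_intros w continuous_on_compose2 [OF G(1)])
       (use range that in auto)
  then show "(\<lambda>x. w x * G (a * (1 - x\<^sup>2))) integrable_on {-1..1}"
    "(\<lambda>x. w x * G (b * (1 - x\<^sup>2))) integrable_on {-1..1}" using ab by auto
  fix x :: real assume x: "x \<in> {-1..1}"
  have "a * (1 - x\<^sup>2) \<le> b * (1 - x\<^sup>2)"
    using ab x by (intro mult_right_mono) (auto simp: abs_square_le_1)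
  then show "w x * G (a * (1 - x\<^sup>2)) \<le> w x * G (b * (1 - x\<^sup>2))"
    using range [of a m x] range [of b m x] x ab
    by (intro mult_left_mono mono_onD [OF G(2)] w) auto
qed

section \<open>Convexity of the curve of pairs of actions\<close>

text \<open>The curve is the graph of \<open>\<phi> x = I (m - J x)\<close> with \<open>J\<close> the inverse of \<open>I\<close>, and
\<open>\<phi>' x = - I' (m - a) / I' a\<close> at \<open>a = J x\<close>. When \<open>x\<close> grows, so does \<open>a\<close>; since \<open>I'\<close> is increasing,
the numerator decreases and the denominator increases, so \<open>\<phi>'\<close> increases.\<close>

lemma convex_graph_of_reflected_pair:
  fixes I I' :: "real \<Rightarrow> real"
  assumes "0 < m"
    and I: "smooth_on {0..m} I" and I': "smooth_on {0..m} I'"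
    and der: "\<And>a. a \<in> {0..m} \<Longrightarrow> (I has_real_derivative I' a) (at a within {0..m})"
    and pos: "\<And>a. a \<in> {0..m} \<Longrightarrow> 0 < I' a"
    and mono: "mono_on {0..m} I'"
    and "I 0 = 0"
  shows "\<exists>A \<phi>. 0 < A \<and> \<phi> A = 0 \<and> (\<lambda>a. (I a, I (m - a))) ` {0..m} = {(x, \<phi> x) | x. x \<in> {0..A}} \<and>
    smooth_on {0..A} \<phi> \<and> antimono_on {0..A} \<phi> \<and> convex_on {0..A} \<phi>"
proof -
  define A J where "A = I m" and "J = the_inv_into {0..m} I"
  note inv = inverse_on_interval [OF \<open>0 < m\<close> der pos, folded J_def, unfolded \<open>I 0 = 0\<close>, folded A_def]
  define \<phi> where "\<phi> = (\<lambda>x. I (m - J x))"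
  define \<phi>' where "\<phi>' = (\<lambda>x. - (I' (m - J x) / I' (J x)))"
  have J: "J x \<in> {0..m}" if "x \<in> {0..A}" for x
    using inv(4) that by blast
  have J_mono: "J x \<le> J y" if "x \<in> {0..A}" "y \<in> {0..A}" "x \<le> y" for x y
    using mono_onD [OF strict_mono_on_imp_mono_on [OF inv(6)]] that by blast
  have I_mono: "I x \<le> I y" if "x \<in> {0..m}" "y \<in> {0..m}" "x \<le> y" for x y
    using mono_onD [OF strict_mono_on_imp_mono_on [OF inv(1)]] that by blast
  have "0 < A"
    using strict_mono_onD [OF inv(1), of 0 m] \<open>0 < m\<close> \<open>I 0 = 0\<close> by (simp add: A_def)
  moreover have "\<phi> A = 0"
    using inv(3) [of m] \<open>0 < m\<close> \<open>I 0 = 0\<close> by (simp add: \<phi>_def A_def)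
  moreover have "(\<lambda>a. (I a, I (m - a))) ` {0..m} = {(x, \<phi> x) | x. x \<in> {0..A}}"
  proof -
    have "(\<lambda>a. (I a, I (m - a))) ` {0..m} = (\<lambda>x. (x, \<phi> x)) ` (I ` {0..m})"
      unfolding image_image using inv(3) by (intro image_cong) (auto simp: \<phi>_def)
    then show ?thesis by (simp only: inv(2) Setcompr_eq_image)
  qed
  moreover have "smooth_on {0..A} \<phi>"
    unfolding \<phi>_def
  proof (rule smooth_on_compose_autonomous [where R = J and P = "\<lambda>a. I (m - a)" and S = "{0..m}"
        and W = "\<lambda>a. 1 / I' a"])
    show "(J has_real_derivative 1 / I' (J x)) (at x within {0..A})" if "x \<in> {0..A}" for x
      using inv(7) that by blast
    show "smooth_on {0..m} (\<lambda>a. 1 / I' a)"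
      by (intro smooth_on_divide smooth_on_const I' pos)
    show "smooth_on {0..m} (\<lambda>a. I (m - a))"
      using I by (rule smooth_on_reflect)
  qed (rule J)
  moreover have "antimono_on {0..A} \<phi>"
  proof (rule monotone_onI)
    fix x y assume xy: "x \<in> {0..A}" "y \<in> {0..A}" "x \<le> y"
    show "\<phi> y \<le> \<phi> x"
      unfolding \<phi>_def using J [OF xy(1)] J [OF xy(2)] J_mono [OF xy] by (intro I_mono) auto
  qed
  moreover have "convex_on {0..A} \<phi>"
  proof (rule convex_on_derivative_mono)
    fix x assume x: "x \<in> {0..A}"
    have "(I has_real_derivative I' (m - J x)) (at (m - J x) within (\<lambda>x. m - J x) ` {0..A})"
    proof (rule has_field_derivative_subset [OF der])
      show "m - J x \<in> {0..m}" using J [OF x] by simp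
      show "(\<lambda>x. m - J x) ` {0..A} \<subseteq> {0..m}" using J by auto
    qed
    moreover have "((\<lambda>x. m - J x) has_real_derivative - (1 / I' (J x))) (at x within {0..A})"
      using inv(7) [OF _ _ x] by (auto intro!: derivative_eq_intros)
    ultimately show "(\<phi> has_real_derivative \<phi>' x) (at x within {0..A})"
      using DERIV_image_chain [of I "I' (m - J x)" "\<lambda>x. m - J x" x "{0..A}" "- (1 / I' (J x))"]
      by (simp add: \<phi>_def \<phi>'_def o_def)
  next
    fix x y assume "0 \<le> x" "x \<le> y" "y \<le> A"
    then have xy: "x \<in> {0..A}" "y \<in> {0..A}" "x \<le> y" by auto
    have le: "I' (J x) \<le> I' (J y)" "I' (m - J y) \<le> I' (m - J x)"
      using J [OF xy(1)] J [OF xy(2)] J_mono [OF xy] by (auto intro!: mono_onD [OF mono])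
    have gt: "0 < I' (J x)" "0 < I' (m - J y)"
      using J [OF xy(1)] J [OF xy(2)] by (auto intro!: pos)
    show "\<phi>' x \<le> \<phi>' y"
      unfolding \<phi>'_def using le gt by (simp add: frac_le)
  qed
  ultimately show ?thesis by blast
qed

section \<open>The planar potential well\<close>

text \<open>The potential energy of the planar Hamiltonian as a function of \<open>\<rho> = s\<^sup>2\<close>; \<open>well'\<close> is its
derivative.\<close>

definition well :: "real \<Rightarrow> real \<Rightarrow> nat \<Rightarrow> real \<Rightarrow> real" where
  "well f g n \<rho> = f * \<rho> - g * \<rho> ^ (2*n + 1)"

definition well' :: "real \<Rightarrow> real \<Rightarrow> nat \<Rightarrow> real \<Rightarrow> real" where
  "well' f g n \<rho> = f - (2*n + 1) * g * \<rho> ^ (2*n)"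

lemma planar_hamiltonian_well: "planar_hamiltonian f g n (s, t) = t\<^sup>2 / 8 + well f g n (s\<^sup>2)"
proof -
  have "s ^ (4*n + 2) = (s\<^sup>2) ^ (2*n + 1)"
    by (subst power_mult [symmetric]) (simp add: algebra_simps)
  then show ?thesis by (simp add: planar_hamiltonian_def well_def)
qed

lemma continuous_on_planar_hamiltonian [continuous_intros]:
  "continuous_on T p \<Longrightarrow> continuous_on T (\<lambda>x. planar_hamiltonian f g n (p x))"
  unfolding planar_hamiltonian_def case_prod_beta' by (intro continuous_intros) auto

lemma well_derivative: "(well f g n has_real_derivative well' f g n \<rho>) (at \<rho> within T)"
  unfolding well_def [abs_def] well'_def
  by (rule derivative_eq_intros refl | simp)+

text \<open>Here \<open>\<rho>c\<close> is the point where the well reaches its maximum: the well increases before it and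
decreases after it.\<close>

locale well_with_peak =
  fixes f g \<rho>c :: real and n :: nat
  assumes g: "g > 0" and n: "n \<ge> 1" and \<rho>c: "0 < \<rho>c" and well'_\<rho>c: "well' f g n \<rho>c = 0"
begin

abbreviation "U \<equiv> well f g n"
abbreviation "U' \<equiv> well' f g n"

lemma U'_strict_antimono:
  assumes "0 \<le> x" "x < y"
  shows "U' y < U' x"
proof -
  have "x ^ (2*n) < y ^ (2*n)" using assms n by (intro power_strict_mono) auto
  then show ?thesis using g by (simp add: well'_def)
qed

lemma U'_pos: "0 \<le> x \<Longrightarrow> x < \<rho>c \<Longrightarrow> 0 < U' x"
  using U'_strict_antimono [of x \<rho>c] well'_\<rho>c by simp

lemma U'_neg: "\<rho>c < x \<Longrightarrow> U' x < 0"
  using U'_strict_antimono [of \<rho>c x] well'_\<rho>c \<rho>c by simp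

lemma U_increasing:
  assumes "0 \<le> x" "x < y" "y \<le> \<rho>c"
  shows "U x < U y"
  by (rule DERIV_pos_imp_increasing_open [OF assms(2)])
     (use assms U'_pos well_derivative [where T = UNIV] in
       \<open>force intro!: DERIV_continuous_on well_derivative\<close>)+

lemma U_decreasing:
  assumes "\<rho>c \<le> x" "x < y"
  shows "U y < U x"
  by (rule DERIV_neg_imp_decreasing_open [OF assms(2)])
     (use assms U'_neg well_derivative [where T = UNIV] in
       \<open>force intro!: DERIV_continuous_on well_derivative\<close>)+

lemma U_0: "U 0 = 0" by (simp add: well_def)

lemma U_nonneg: "0 \<le> x \<Longrightarrow> x \<le> \<rho>c \<Longrightarrow> 0 \<le> U x"
  using U_increasing [of 0 x] U_0 by (cases "x = 0") auto

lemma U_mono: "0 \<le> x \<Longrightarrow> x \<le> y \<Longrightarrow> y \<le> \<rho>c \<Longrightarrow> U x \<le> U y"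
  using U_increasing [of x y] by (cases "x = y") auto

end

text \<open>The total energy \<open>m\<close> lies strictly below the peak. The turning point \<open>\<rho>m\<close> is where the well
attains \<open>m\<close>; from there to the peak the well is higher than the total energy and forms a barrier.\<close>

locale subcritical_well = well_with_peak +
  fixes m \<rho>m :: real
  assumes m: "m > 0" and \<rho>m: "0 < \<rho>m" "\<rho>m < \<rho>c" and well_\<rho>m: "U \<rho>m = m"
begin

section \<open>The action as a smooth function of the energy\<close>

definition R :: "real \<Rightarrow> real" where
  "R = the_inv_into {0..\<rho>m} U"

lemma R_simps:
  "\<rho> \<in> {0..\<rho>m} \<Longrightarrow> R (U \<rho>) = \<rho>"
  "R ` {0..m} = {0..\<rho>m}"
  "y \<in> {0..m} \<Longrightarrow> U (R y) = y"
  "strict_mono_on {0..m} R"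
  "y \<in> {0..m} \<Longrightarrow> (R has_real_derivative 1 / U' (R y)) (at y within {0..m})"
  using inverse_on_interval [of 0 \<rho>m U U', OF \<rho>m(1) well_derivative] U'_pos \<rho>m
  by (auto simp: R_def [symmetric] U_0 well_\<rho>m)

lemma R_range: "y \<in> {0..m} \<Longrightarrow> R y \<in> {0..\<rho>m}"
  using R_simps(2) by blast

lemma R_mono: "x \<in> {0..m} \<Longrightarrow> y \<in> {0..m} \<Longrightarrow> x \<le> y \<Longrightarrow> R x \<le> R y"
  using mono_onD [OF strict_mono_on_imp_mono_on [OF R_simps(4)]] by blast

lemma quotient_pos:
  assumes "0 \<le> \<rho>" "\<rho> \<le> \<rho>m"
  shows "0 < f - g * \<rho> ^ (2*n)"
proof -
  have "0 < U' \<rho>" using assms \<rho>m by (intro U'_pos) auto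
  moreover have "U' \<rho> \<le> f - g * \<rho> ^ (2*n)"
    using g assms by (simp add: well'_def algebra_simps)
  ultimately show ?thesis by simp
qed

text \<open>The square root of \<open>R\<close> is not differentiable at \<open>0\<close>. From \<open>U \<rho> = \<rho> * (f - g * \<rho> ^ (2*n))\<close> one gets
\<open>sqrt (R y) = sqrt y * q y\<close>, and the factor \<open>q\<close> is smooth up to \<open>0\<close>. It is increasing, with
increasing derivative \<open>q'\<close>, because the well softens as \<open>\<rho>\<close> grows. This is what makes the actions
convex.\<close>

definition q :: "real \<Rightarrow> real" where
  "q y = (f - g * R y ^ (2*n)) powr (- 1/2)"

definition q' :: "real \<Rightarrow> real" where
  "q' y = (f - g * R y ^ (2*n)) powr (- 3/2) * (g * real n * R y ^ (2*n - 1)) * (1 / U' (R y))"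

lemma q_pos: "y \<in> {0..m} \<Longrightarrow> 0 < q y"
  using quotient_pos [of "R y"] R_range [of y] by (simp add: q_def)

lemma R_eq: 
  assumes "y \<in> {0..m}"
  shows "R y = y * (q y)\<^sup>2"
proof -
  have p: "0 < f - g * R y ^ (2*n)"
    using quotient_pos R_range [OF assms] by auto
  have "(q y)\<^sup>2 = 1 / (f - g * R y ^ (2*n))"
    using p by (simp add: q_def power2_eq_square powr_add [symmetric] powr_minus_divide)
  moreover have "R y * (f - g * R y ^ (2*n)) = y"
    using R_simps(3) [OF assms] by (simp add: well_def algebra_simps)
  ultimately show ?thesis using p by (metis mult.right_neutral nonzero_mult_div_cancel_right
    order_less_irrefl times_divide_eq_right)
qed

lemma sqrt_R: "y \<in> {0..m} \<Longrightarrow> sqrt (R y) = sqrt y * q y"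
  using q_pos [of y] by (simp add: R_eq real_sqrt_mult)

lemma q_derivative:
  assumes y: "y \<in> {0..m}"
  shows "(q has_real_derivative q' y) (at y within {0..m})"
proof -
  have p: "0 < f - g * R y ^ (2*n)"
    using quotient_pos R_range [OF y] by auto
  have "((\<lambda>y. f - g * R y ^ (2*n)) has_real_derivative
      - (g * (real (2*n) * R y ^ (2*n - 1) * (1 / U' (R y))))) (at y within {0..m})"
    using R_simps(5) [OF y] by (auto intro!: derivative_eq_intros)
  from DERIV_chain2 [OF has_real_derivative_powr [OF p, of "- 1/2"] this]
  show ?thesis unfolding q_def [abs_def] q'_def by (simp add: field_simps)
qed

lemma smooth_on_U': "smooth_on T U'"
  unfolding well'_def [abs_def]
  by (intro smooth_on_diff smooth_on_mult smooth_on_power smooth_on_const smooth_on_ident)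

lemma smooth_on_compose_R:
  assumes "smooth_on {0..\<rho>m} P"
  shows "smooth_on {0..m} (\<lambda>y. P (R y))"
proof (rule smooth_on_compose_autonomous [OF R_range R_simps(5) assms])
  show "smooth_on {0..\<rho>m} (\<lambda>\<rho>. 1 / U' \<rho>)"
    using \<rho>m by (intro smooth_on_divide smooth_on_const smooth_on_U' U'_pos) auto
qed

lemma smooth_on_quotient_powr: "smooth_on {0..\<rho>m} (\<lambda>\<rho>. (f - g * \<rho> ^ (2*n)) powr r)"
  using quotient_pos
  by (intro smooth_on_powr smooth_on_diff smooth_on_mult smooth_on_power smooth_on_const smooth_on_ident)
     auto

lemma smooth_on_q: "smooth_on {0..m} q"
  unfolding q_def [abs_def] by (rule smooth_on_compose_R [OF smooth_on_quotient_powr])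

lemma smooth_on_q': "smooth_on {0..m} q'"
  unfolding q'_def [abs_def]
proof (rule smooth_on_compose_R)
  show "smooth_on {0..\<rho>m} (\<lambda>\<rho>. (f - g * \<rho> ^ (2*n)) powr (- 3/2) * (g * real n * \<rho> ^ (2*n - 1))
      * (1 / U' \<rho>))"
    using \<rho>m by (intro smooth_on_mult smooth_on_quotient_powr smooth_on_power smooth_on_const
      smooth_on_ident smooth_on_divide smooth_on_U' U'_pos) auto
qed

lemma q'_nonneg: "y \<in> {0..m} \<Longrightarrow> 0 \<le> q' y"
  using R_range [of y] g \<rho>m U'_pos [of "R y"] by (auto simp: q'_def)

lemma mono_on_q: "mono_on {0..m} q"
proof (rule mono_onI)
  fix x y assume xy: "x \<in> {0..m}" "y \<in> {0..m}" "x \<le> y"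
  have "R x ^ (2*n) \<le> R y ^ (2*n)"
    using R_mono [OF xy] R_range [OF xy(1)] by (intro power_mono) auto
  then show "q x \<le> q y"
    unfolding q_def using g quotient_pos [of "R y"] R_range [OF xy(2)]
    by (intro powr_mono2') auto
qed

lemma mono_on_q': "mono_on {0..m} q'"
proof (rule mono_onI)
  fix x y assume xy: "x \<in> {0..m}" "y \<in> {0..m}" "x \<le> y"
  have R: "0 \<le> R x" "R x \<le> R y" "R y \<le> \<rho>m"
    using R_mono [OF xy] R_range [OF xy(1)] R_range [OF xy(2)] by auto
  have U': "U' (R y) \<le> U' (R x)" "0 < U' (R y)" "0 < U' (R x)"
    using R \<rho>m U'_strict_antimono [of "R x" "R y"] U'_pos by (cases "R x = R y"; force)+
  have "R x ^ (2*n) \<le> R y ^ (2*n)"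
    using R by (intro power_mono) auto
  then have "(f - g * R x ^ (2*n)) powr (- 3/2) \<le> (f - g * R y ^ (2*n)) powr (- 3/2)"
    using g quotient_pos [of "R y"] R by (intro powr_mono2') auto
  then show "q' x \<le> q' y"
    unfolding q'_def using g R U'
    by (intro mult_mono power_mono frac_le mult_nonneg_nonneg) auto
qed

text \<open>This is the area enclosed by the closed curve at energy \<open>a\<close>, divided by \<open>2 * pi\<close>. Slices at constant
momentum \<open>t\<close> have length \<open>2 * sqrt (R (a - t\<^sup>2 / 8))\<close>, and the substitution
\<open>t = sqrt (8 * a) * x\<close> collects all square roots of \<open>a\<close> into one factor \<open>a\<close>, so that the formula is
smooth up to \<open>a = 0\<close>; \<open>I'\<close> is its derivative.\<close>

definition I :: "real \<Rightarrow> real" where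
  "I a = sqrt 8 / pi * (a * integral {-1..1} (\<lambda>x. sqrt (1 - x\<^sup>2) * q (a * (1 - x\<^sup>2))))"

definition I' :: "real \<Rightarrow> real" where
  "I' a = sqrt 8 / pi * (integral {-1..1} (\<lambda>x. sqrt (1 - x\<^sup>2) * q (a * (1 - x\<^sup>2)))
      + a * integral {-1..1} (\<lambda>x. sqrt (1 - x\<^sup>2) * (1 - x\<^sup>2) * q' (a * (1 - x\<^sup>2))))"

lemma continuous_semicircle:
  "continuous_on {-1..1} (\<lambda>x::real. sqrt (1 - x\<^sup>2))"
  "continuous_on {-1..1} (\<lambda>x::real. sqrt (1 - x\<^sup>2) * (1 - x\<^sup>2))"
  by (intro continuous_intros)+

lemma semicircle_nonneg:
  fixes x :: real
  assumes "x \<in> {-1..1}"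
  shows "0 \<le> sqrt (1 - x\<^sup>2)" "0 \<le> sqrt (1 - x\<^sup>2) * (1 - x\<^sup>2)"
  using assms by (auto simp: abs_square_le_1)

lemma I_derivative:
  assumes a: "a \<in> {0..m}"
  shows "(I has_real_derivative I' a) (at a within {0..m})"
proof -
  have "((\<lambda>a. integral {-1..1} (\<lambda>x. sqrt (1 - x\<^sup>2) * q (a * (1 - x\<^sup>2)))) has_real_derivative
      integral {-1..1} (\<lambda>x. sqrt (1 - x\<^sup>2) * (1 - x\<^sup>2) * q' (a * (1 - x\<^sup>2)))) (at a within {0..m})"
    by (intro weighted_average_derivative continuous_semicircle q_derivative
        smooth_on_imp_continuous_on smooth_on_q' a)
  from DERIV_cmult [OF DERIV_mult [OF DERIV_ident this], of "sqrt 8 / pi"]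
  show ?thesis
    unfolding I_def [abs_def] I'_def by (simp add: mult.commute)
qed

lemma smooth_on_I: "smooth_on {0..m} I"
  unfolding I_def [abs_def]
  by (intro smooth_on_mult smooth_on_const smooth_on_ident smooth_on_weighted_average
      continuous_semicircle smooth_on_q)

lemma smooth_on_I': "smooth_on {0..m} I'"
  unfolding I'_def [abs_def]
  by (intro smooth_on_mult smooth_on_add smooth_on_const smooth_on_ident smooth_on_weighted_average
      continuous_semicircle smooth_on_q smooth_on_q')

lemma average_q_pos:
  assumes a: "a \<in> {0..m}"
  shows "0 < integral {-1..1} (\<lambda>x. sqrt (1 - x\<^sup>2) * q (a * (1 - x\<^sup>2)))"
proof -
  note range = semicircle_argument [OF a]
  \<comment> \<open>Strict positivity, since the integrand is continuous and vanishes only at the end points.\<close>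
  have "integral {-1..1::real} (\<lambda>x. 0) < integral {-1..1} (\<lambda>x. sqrt (1 - x\<^sup>2) * q (a * (1 - x\<^sup>2)))"
  proof (rule integral_less_real)
    show "continuous_on {-1..1} (\<lambda>x. sqrt (1 - x\<^sup>2) * q (a * (1 - x\<^sup>2)))"
      by (intro continuous_on_mult continuous_semicircle
          continuous_on_compose2 [OF smooth_on_imp_continuous_on [OF smooth_on_q]] continuous_intros)
         (use range in auto)
    fix x :: real assume "x \<in> {-1<..<1}"
    then show "0 < sqrt (1 - x\<^sup>2) * q (a * (1 - x\<^sup>2))"
      using range [of x] by (intro mult_pos_pos q_pos) (auto simp: abs_square_less_1)
  qed auto
  then show ?thesis by simp
qed

lemma average_q'_nonneg:
  assumes a: "a \<in> {0..m}"
  shows "0 \<le> integral {-1..1} (\<lambda>x. sqrt (1 - x\<^sup>2) * (1 - x\<^sup>2) * q' (a * (1 - x\<^sup>2)))"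
proof -
  note range = semicircle_argument [OF a]
  show ?thesis
    by (intro integral_nonneg mult_nonneg_nonneg q'_nonneg semicircle_nonneg range
        integrable_continuous_real continuous_on_mult [OF continuous_semicircle(2)]
        continuous_on_compose2 [OF smooth_on_imp_continuous_on [OF smooth_on_q']] continuous_intros)
       (use range in \<open>auto simp: abs_square_le_1\<close>)
qed

lemma I'_pos: "a \<in> {0..m} \<Longrightarrow> 0 < I' a"
  unfolding I'_def using average_q_pos [of a] average_q'_nonneg [of a]
  by (intro mult_pos_pos add_pos_nonneg mult_nonneg_nonneg) auto

lemma mono_on_I': "mono_on {0..m} I'"
proof (rule mono_onI)
  fix a b assume ab: "a \<in> {0..m}" "b \<in> {0..m}" "a \<le> b"
  have "integral {-1..1} (\<lambda>x. sqrt (1 - x\<^sup>2) * q (a * (1 - x\<^sup>2)))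
      \<le> integral {-1..1} (\<lambda>x. sqrt (1 - x\<^sup>2) * q (b * (1 - x\<^sup>2)))"
    by (rule weighted_average_mono [OF continuous_semicircle(1) semicircle_nonneg(1)
          smooth_on_imp_continuous_on [OF smooth_on_q] mono_on_q])
       (use ab in auto)
  moreover have "integral {-1..1} (\<lambda>x. sqrt (1 - x\<^sup>2) * (1 - x\<^sup>2) * q' (a * (1 - x\<^sup>2)))
      \<le> integral {-1..1} (\<lambda>x. sqrt (1 - x\<^sup>2) * (1 - x\<^sup>2) * q' (b * (1 - x\<^sup>2)))"
    by (rule weighted_average_mono [OF continuous_semicircle(2) semicircle_nonneg(2)
          smooth_on_imp_continuous_on [OF smooth_on_q'] mono_on_q'])
       (use ab in auto)
  ultimately show "I' a \<le> I' b"
    unfolding I'_def using ab average_q'_nonneg [OF ab(1)]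
    by (intro mult_left_mono add_mono mult_mono) auto
qed

lemma convex_graph_I:
  "\<exists>A \<phi>. 0 < A \<and> \<phi> A = 0 \<and> (\<lambda>a. (I a, I (m - a))) ` {0..m} = {(x, \<phi> x) | x. x \<in> {0..A}} \<and>
    smooth_on {0..A} \<phi> \<and> antimono_on {0..A} \<phi> \<and> convex_on {0..A} \<phi>"
  by (rule convex_graph_of_reflected_pair [OF m smooth_on_I smooth_on_I' I_derivative I'_pos mono_on_I'])
     (auto simp: I_def)

end

section \<open>Inside of a set and clopen components\<close>

text \<open>A connected subset of the complement of \<open>S\<close> that meets \<open>D\<close> cannot cross the frontier of \<open>D\<close>.\<close>

lemma subset_inside_if_frontier_subset:
  fixes S D :: "'a::real_normed_vector set"
  assumes "bounded D" "D \<inter> S = {}" "frontier D \<subseteq> S"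
  shows "D \<subseteq> inside S"
proof
  fix x assume x: "x \<in> D"
  let ?C = "connected_component_set (- S) x"
  have "x \<in> ?C" using x assms(2) by auto
  moreover have "?C \<inter> frontier D = {}"
    using assms(3) connected_component_subset [of "- S" x] by blast
  ultimately have "?C \<subseteq> D"
    using connected_Int_frontier [OF connected_connected_component, of "- S" x D] x by blast
  then show "x \<in> inside S"
    using x assms(1,2) bounded_subset by (auto simp: inside_def)
qed

lemma not_inside_if_unbounded_connected:
  assumes "connected T" "x \<in> T" "T \<inter> S = {}" "\<not> bounded T"
  shows "x \<notin> inside S"
proof -
  have "T \<subseteq> connected_component_set (- S) x"
    using assms by (intro connected_component_maximal) auto
  then show ?thesis using assms(4) bounded_subset by (auto simp: inside_def)
qed

lemma components_if_clopen:
  fixes C Y :: "'a::topological_space set"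
  assumes "C \<noteq> {}" "connected C" and U: "C = Y \<inter> U" "open U" and F: "C = Y \<inter> F" "closed F"
  shows "C \<in> components Y"
  unfolding in_components_maximal
proof (intro conjI allI impI)
  fix T assume T: "T \<noteq> {} \<and> C \<subseteq> T \<and> T \<subseteq> Y \<and> connected T"
  then have "\<not> (T \<inter> U \<noteq> {} \<and> T \<inter> (- F) \<noteq> {} \<and> U \<inter> (- F) \<inter> T = {} \<and> T \<subseteq> U \<union> (- F))"
    using U(2) F(2) connectedD [of T U "- F"] by blast
  then show "T = C" using T U(1) F(1) assms(1) by blast
qed (use assms in auto)

lemma not_bounded_ray:
  fixes y :: "'a::real_normed_vector"
  assumes "y \<noteq> 0"
  shows "\<not> bounded ((\<lambda>l. l *\<^sub>R y) ` {1..})"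
proof
  assume "bounded ((\<lambda>l. l *\<^sub>R y) ` {1..})"
  then obtain B where B: "\<And>l. l \<ge> 1 \<Longrightarrow> norm (l *\<^sub>R y) \<le> B"
    unfolding bounded_iff by auto
  have "norm ((max 1 ((B + 1) / norm y)) *\<^sub>R y) \<ge> (B + 1) / norm y * norm y"
    by (simp del: nonzero_mult_div_cancel_right times_divide_eq_left add: mult_right_mono)
  then show False using B [of "max 1 ((B + 1) / norm y)"] assms by simp
qed

section \<open>The area enclosed by a planar level\<close>

context subcritical_well
begin

abbreviation "K \<equiv> planar_hamiltonian f g n"

lemma K_eq: "K y = (snd y)\<^sup>2 / 8 + U ((fst y)\<^sup>2)"
  by (cases y) (simp add: planar_hamiltonian_well)

lemma le_\<rho>m_iff:
  assumes "0 \<le> x" "x \<le> \<rho>c"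
  shows "x \<le> \<rho>m \<longleftrightarrow> U x \<le> m"
  using assms U_mono [of x \<rho>m] U_increasing [of \<rho>m x] \<rho>m well_\<rho>m by force

lemma m_less_U_\<rho>c: "m < U \<rho>c"
  using U_increasing [of \<rho>m \<rho>c] \<rho>m well_\<rho>m by simp

lemma continuous_on_U [continuous_intros]: "continuous_on T p \<Longrightarrow> continuous_on T (\<lambda>x. U (p x))"
  unfolding well_def by (intro continuous_intros)

text \<open>The set \<open>P\<close> is the common projection of the bounded component to both planes, and \<open>disc a\<close> is the
region that the part of the level \<open>{K = a}\<close> in \<open>P\<close> encloses.\<close>

definition P :: "(real \<times> real) set" where
  "P = {y. (fst y)\<^sup>2 \<le> \<rho>m \<and> K y \<le> m}"

definition disc :: "real \<Rightarrow> (real \<times> real) set" where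
  "disc a = {y. (fst y)\<^sup>2 < \<rho>c \<and> K y < a}"

lemma open_disc: "open (disc a)"
  unfolding disc_def by (intro open_Collect_conj open_Collect_less continuous_intros)

lemma bounded_disc: "bounded (disc a)"
proof -
  have "disc a \<subseteq> cball 0 (sqrt \<rho>c) \<times> cball 0 (sqrt (8 * a))"
  proof
    fix y assume "y \<in> disc a"
    then have y: "(fst y)\<^sup>2 < \<rho>c" "K y < a" by (auto simp: disc_def)
    then have "(snd y)\<^sup>2 \<le> 8 * a" using U_nonneg [of "(fst y)\<^sup>2"] by (simp add: K_eq)
    then show "y \<in> cball 0 (sqrt \<rho>c) \<times> cball 0 (sqrt (8 * a))"
      using y(1) real_sqrt_le_mono [of "(snd y)\<^sup>2"] real_sqrt_le_mono [of "(fst y)\<^sup>2" \<rho>c]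
      by (cases y) auto
  qed
  then show ?thesis by (rule bounded_subset [rotated]) (intro bounded_Times bounded_cball)
qed

text \<open>Moving radially away from the origin increases the energy as long as the peak has not been passed;
so each closed energy curve encloses a region that is star-shaped about the origin, and a point
outside of it escapes to infinity along its ray.\<close>

lemma K_scale_mono:
  assumes "1 \<le> l" "(fst (l *\<^sub>R y))\<^sup>2 \<le> \<rho>c"
  shows "K y \<le> K (l *\<^sub>R y)"
proof -
  have l: "1 \<le> l\<^sup>2" using assms(1) by simp
  have "(snd y)\<^sup>2 \<le> (snd (l *\<^sub>R y))\<^sup>2" "(fst y)\<^sup>2 \<le> (fst (l *\<^sub>R y))\<^sup>2"
    using mult_right_mono [OF l, of "(snd y)\<^sup>2"] mult_right_mono [OF l, of "(fst y)\<^sup>2"]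
    by (auto simp: power_mult_distrib)
  then show ?thesis
    unfolding K_eq using assms(2) by (intro add_mono divide_right_mono U_mono) auto
qed

lemma inside_level:
  assumes a: "0 \<le> a" "a \<le> m"
  shows "inside {y \<in> P. K y = a} = disc a"
proof (intro equalityI)
  have mem: "y \<in> {y \<in> P. K y = a}" if "K y = a" "(fst y)\<^sup>2 \<le> \<rho>c" for y
  proof -
    have "U ((fst y)\<^sup>2) \<le> K y" by (simp add: K_eq)
    then show ?thesis using that a le_\<rho>m_iff [of "(fst y)\<^sup>2"] by (simp add: P_def)
  qed
  show "disc a \<subseteq> inside {y \<in> P. K y = a}"
  proof (rule subset_inside_if_frontier_subset [OF bounded_disc])
    show "disc a \<inter> {y \<in> P. K y = a} = {}" by (auto simp: disc_def)
    show "frontier (disc a) \<subseteq> {y \<in> P. K y = a}"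
    proof
      fix y assume y: "y \<in> frontier (disc a)"
      have "closed {y. (fst y)\<^sup>2 \<le> \<rho>c \<and> K y \<le> a}"
        by (intro closed_Collect_conj closed_Collect_le continuous_intros)
      then have "closure (disc a) \<subseteq> {y. (fst y)\<^sup>2 \<le> \<rho>c \<and> K y \<le> a}"
        by (rule closure_minimal [rotated]) (auto simp: disc_def)
      then have le: "(fst y)\<^sup>2 \<le> \<rho>c" "K y \<le> a" and "y \<notin> disc a"
        using y open_disc [of a] by (auto simp: frontier_def interior_open)
      moreover have "(fst y)\<^sup>2 \<noteq> \<rho>c"
      proof
        assume "(fst y)\<^sup>2 = \<rho>c"
        then have "U \<rho>c \<le> K y" by (simp add: K_eq)
        then show False using le(2) a m_less_U_\<rho>c by simp
      qed
      ultimately show "y \<in> {y \<in> P. K y = a}"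
        by (intro mem) (auto simp: disc_def)
    qed
  qed
  show "inside {y \<in> P. K y = a} \<subseteq> disc a"
  proof (rule subsetI, rule ccontr)
    fix y assume ins: "y \<in> inside {y \<in> P. K y = a}" and nd: "y \<notin> disc a"
    have nm: "y \<notin> {y \<in> P. K y = a}"
      using ins by (auto simp: inside_def)
    have K0: "K 0 = 0" by (simp add: K_eq U_0)
    have "y \<noteq> 0"
      using nd nm mem [of 0] a \<rho>m K0 by (cases "a = 0") (auto simp: disc_def)
    moreover have "l *\<^sub>R y \<notin> {y \<in> P. K y = a}" if "1 \<le> l" for l
    proof
      assume A: "l *\<^sub>R y \<in> {y \<in> P. K y = a}"
      then have le: "(fst (l *\<^sub>R y))\<^sup>2 \<le> \<rho>c" using \<rho>m by (auto simp: P_def)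
      have "K (l *\<^sub>R y) = a" using A by blast
      then have "K y \<le> a" using K_scale_mono [OF that le] by simp
      moreover note le
      moreover have "1 \<le> l\<^sup>2" using that by simp
      then have "(fst y)\<^sup>2 \<le> (fst (l *\<^sub>R y))\<^sup>2"
        using mult_right_mono [of 1 "l\<^sup>2" "(fst y)\<^sup>2"] by (simp add: power_mult_distrib)
      moreover have "(fst (l *\<^sub>R y))\<^sup>2 \<noteq> \<rho>c"
        using A \<rho>m by (auto simp: P_def)
      ultimately show False using nd nm mem [of y] by (auto simp: disc_def)
    qed
    moreover have "connected ((\<lambda>l. l *\<^sub>R y) ` {1..})"
      by (intro connected_continuous_image continuous_intros) auto
    moreover have "y \<in> (\<lambda>l. l *\<^sub>R y) ` {1..}" by (rule image_eqI [of _ _ 1]) auto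
    ultimately show False
      using not_inside_if_unbounded_connected [of "(\<lambda>l. l *\<^sub>R y) ` {1..}" y "{y \<in> P. K y = a}"]
        not_bounded_ray [of y] ins by blast
  qed
qed

lemma slice_argument:
  assumes "t\<^sup>2 \<le> 8 * a" "a \<le> m"
  shows "a - t\<^sup>2 / 8 \<in> {0..m}"
  unfolding atLeastAtMost_iff using assms zero_le_power2 [of t] by (intro conjI) linarith+

text \<open>For larger \<open>\<bar>t\<bar>\<close> the kinetic energy alone exceeds \<open>a\<close>, hence the indicator.\<close>

lemma disc_slice:
  assumes a: "0 < a" "a \<le> m"
  shows "emeasure lborel ((\<lambda>s. (s, t)) -` disc a)
    = ennreal (2 * sqrt (R (a - t\<^sup>2 / 8))) * indicator {- sqrt (8 * a)..sqrt (8 * a)} t"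
proof (cases "t \<in> {- sqrt (8 * a)..sqrt (8 * a)}")
  case True
  then have "\<bar>t\<bar> \<le> sqrt (8 * a)" by auto
  then have "t\<^sup>2 \<le> 8 * a" using a sqrt_ge_absD by blast
  then have y: "a - t\<^sup>2 / 8 \<in> {0..m}"
    using a by (intro slice_argument) auto
  have "(s, t) \<in> disc a \<longleftrightarrow> s \<in> {- sqrt (R (a - t\<^sup>2 / 8)) <..< sqrt (R (a - t\<^sup>2 / 8))}" for s
  proof -
    have "(s, t) \<in> disc a \<longleftrightarrow> s\<^sup>2 < \<rho>c \<and> U (s\<^sup>2) < U (R (a - t\<^sup>2 / 8))"
      using R_simps(3) [OF y] by (auto simp: disc_def K_eq)
    also have "\<dots> \<longleftrightarrow> s\<^sup>2 < R (a - t\<^sup>2 / 8)"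
      using R_range [OF y] \<rho>m U_increasing [of "s\<^sup>2" "R (a - t\<^sup>2 / 8)"]
        U_mono [of "R (a - t\<^sup>2 / 8)" "s\<^sup>2"] by force
    also have "\<dots> \<longleftrightarrow> \<bar>s\<bar> < sqrt (R (a - t\<^sup>2 / 8))"
      by (metis real_sqrt_abs real_sqrt_less_iff)
    finally show ?thesis by auto
  qed
  then have "(\<lambda>s. (s, t)) -` disc a = {- sqrt (R (a - t\<^sup>2 / 8)) <..< sqrt (R (a - t\<^sup>2 / 8))}"
    by (intro set_eqI) (simp only: vimage_eq)
  then show ?thesis using True R_range [OF y] by simp
next
  case False
  then have "sqrt (8 * a) < \<bar>t\<bar>" by auto
  then have "8 * a < t\<^sup>2" using real_less_lsqrt by (metis abs_ge_zero not_less power2_abs real_sqrt_le_iff real_sqrt_abs)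
  then have "a < K (s, t)" if "s\<^sup>2 < \<rho>c" for s
    using U_nonneg [of "s\<^sup>2"] that by (simp add: K_eq)
  then have "(s, t) \<notin> disc a" for s by (fastforce simp: disc_def)
  then have "(\<lambda>s. (s, t)) -` disc a = {}" by (simp add: vimage_def)
  then show ?thesis using False by simp
qed

lemma slice_integral:
  assumes a: "0 < a" "a \<le> m"
  shows "((\<lambda>t. 2 * sqrt (R (a - t\<^sup>2 / 8))) has_integral (2 * pi * I a)) {- sqrt (8 * a)..sqrt (8 * a)}"
proof -
  define c where "c = sqrt (8 * a)"
  have c: "0 < c" "c\<^sup>2 = 8 * a" using a by (auto simp: c_def)
  let ?h = "\<lambda>x. sqrt (1 - x\<^sup>2) * q (a * (1 - x\<^sup>2))"
  have "a \<in> {0..m}" using a by simp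
  note range = semicircle_argument [OF this]
  have "continuous_on {-1..1} ?h"
    by (intro continuous_on_mult continuous_semicircle
        continuous_on_compose2 [OF smooth_on_imp_continuous_on [OF smooth_on_q]] continuous_intros)
       (use range in auto)
  then have "(?h has_integral integral {-1..1} ?h) {-1..1}"
    by (intro integrable_integral integrable_continuous_real)
  \<comment> \<open>The substitution t = c * x.\<close>
  from has_integral_stretch_real [OF has_integral_mult_right [OF this, of "2 * sqrt a"], of "1 / c"]
  have int: "((\<lambda>t. 2 * sqrt a * ?h (1 / c * t)) has_integral c * (2 * sqrt a * integral {-1..1} ?h))
      ((\<lambda>t. t / (1 / c)) ` {-1..1})"
    using c by simp
  have img: "(\<lambda>t. t / (1 / c)) ` {-1..1} = {- c..c}"
  proof -
    have "(\<lambda>t. t / (1 / c)) ` {-1..1} = (*) c ` {-1..1}" by (simp add: mult.commute)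
    then show ?thesis using c by (simp add: image_mult_atLeastAtMost)
  qed
  have val: "c * (2 * sqrt a * integral {-1..1} ?h) = 2 * pi * I a"
    using a by (simp add: c_def I_def real_sqrt_mult)
  have eq: "2 * sqrt a * ?h (1 / c * t) = 2 * sqrt (R (a - t\<^sup>2 / 8))" if "t \<in> {- c..c}" for t
  proof -
    have x: "1 / c * t \<in> {-1..1}" using that c by (auto simp: field_simps)
    have "a - t\<^sup>2 / 8 = a * (1 - (1 / c * t)\<^sup>2)"
      using a by (simp add: power_mult_distrib power_divide c field_simps)
    then show ?thesis
      using sqrt_R [OF range [OF x]] a by (simp add: real_sqrt_mult)
  qed
  show ?thesis
    unfolding c_def [symmetric] by (rule has_integral_eq [OF eq int [unfolded img val]])
qed

lemma measure_disc:
  assumes a: "0 \<le> a" "a \<le> m"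
  shows "measure lborel (disc a) = 2 * pi * I a"
proof (cases "a = 0")
  case True
  have "0 \<le> K y" if "(fst y)\<^sup>2 < \<rho>c" for y
    unfolding K_eq using that by (intro add_nonneg_nonneg U_nonneg) auto
  then have "disc 0 = {}" by (auto simp: disc_def not_less)
  then show ?thesis using True by (simp add: I_def)
next
  case False
  then have a: "0 < a" "a \<le> m" using a by auto
  have "disc a \<in> sets (lborel \<Otimes>\<^sub>M lborel)" 
    unfolding lborel_prod using open_disc [of a] by simp
  from lborel_pair.emeasure_pair_measure_alt2 [OF this]
  have "emeasure lborel (disc a) = (\<integral>\<^sup>+t. emeasure lborel ((\<lambda>s. (s, t)) -` disc a) \<partial>lborel)"
    by (simp add: lborel_prod)
  also have "\<dots> = (\<integral>\<^sup>+t. ennreal (2 * sqrt (R (a - t\<^sup>2 / 8))) * indicator {- sqrt (8 * a)..sqrt (8 * a)} t \<partial>lborel)"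
    by (simp only: disc_slice [OF a])
  also have "\<dots> = ennreal (2 * pi * I a)"
  proof (rule nn_integral_has_integral_lebesgue' [OF _ slice_integral [OF a]])
    fix t assume "t \<in> {- sqrt (8 * a)..sqrt (8 * a)}"
    then have "\<bar>t\<bar> \<le> sqrt (8 * a)" by auto
    then have "t\<^sup>2 \<le> 8 * a" using a sqrt_ge_absD by blast
    then show "0 \<le> 2 * sqrt (R (a - t\<^sup>2 / 8))"
      using R_range [OF slice_argument [of t a]] a by simp
  qed
  finally show ?thesis
    using average_q_pos [of a] a by (simp add: measure_def I_def)
qed

lemma action_eq_I:
  assumes "a \<in> {0..m}"
  shows "action K P a = I a"
  using assms by (simp add: action_def inside_level measure_disc)

end

section \<open>The regularized Hamiltonian\<close>

lemma linear_proj1: "bounded_linear proj1"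
proof -
  have "bounded_linear (\<lambda>x :: complex \<times> complex. (Re (fst x), Re (snd x)))"
    by (intro bounded_linear_Pair bounded_linear_compose [OF bounded_linear_Re]
        bounded_linear_fst bounded_linear_snd)
  then show ?thesis by (simp add: proj1_def case_prod_beta')
qed

lemma linear_proj2: "bounded_linear proj2"
proof -
  have "bounded_linear (\<lambda>x :: complex \<times> complex. (Im (fst x), Im (snd x)))"
    by (intro bounded_linear_Pair bounded_linear_compose [OF bounded_linear_Im]
        bounded_linear_fst bounded_linear_snd)
  then show ?thesis by (simp add: proj2_def case_prod_beta')
qed

lemma proj_simps [simp]:
  "fst (proj1 x) = Re (fst x)" "snd (proj1 x) = Re (snd x)"
  "fst (proj2 x) = Im (fst x)" "snd (proj2 x) = Im (snd x)"
  by (auto simp: proj1_def proj2_def case_prod_beta')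

lemma norm_power2_levi_civita_momentum:
  "(norm (w / (2 * cnj z)))\<^sup>2 = (norm w)\<^sup>2 / (4 * (norm z)\<^sup>2)"
  by (simp add: norm_divide norm_mult power_divide power_mult_distrib)

text \<open>With \<open>X = (Re z)\<^sup>2\<close> and \<open>Y = (Im z)\<^sup>2\<close> one has \<open>norm (z\<^sup>2) = X + Y\<close>, \<open>Re (z\<^sup>2) = X - Y\<close> and
\<open>(Im (z\<^sup>2))\<^sup>2 = 4 * X * Y\<close>, so that the pullback is an expression in \<open>X\<close> and \<open>Y\<close> to which
the separation identity applies.\<close>

lemma lc_pullback_separated:
  assumes "fst x \<noteq> 0"
  shows "lc_pullback (hamiltonian (potential m g n)) f x
    = planar_hamiltonian f g n (proj1 x) + planar_hamiltonian f g n (proj2 x) - m"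
proof (cases x)
  case (Pair z w)
  define X Y where "X = (Re z)\<^sup>2" and "Y = (Im z)\<^sup>2"
  have z: "z \<noteq> 0" using assms Pair by simp
  have norm: "(norm z)\<^sup>2 = X + Y" by (simp add: X_def Y_def cmod_power2)
  then have pos: "0 < X + Y" using z by (metis zero_less_norm_iff zero_less_power)
  let ?A = "\<Sum>k\<le>n. Ccoef n k * (X - Y) ^ (2*n - 2*k) * (X * Y) ^ k"
  have "(\<Sum>k\<le>n. Ccoef n k / 2 ^ (2*k) * Re (z\<^sup>2) ^ (2*n - 2*k) * Im (z\<^sup>2) ^ (2*k)) = ?A"
  proof (rule sum.cong [OF refl])
    fix k
    have "(Im (z\<^sup>2))\<^sup>2 = 2\<^sup>2 * (X * Y)"
      by (simp add: X_def Y_def power_mult_distrib Im_power2)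
    then have "Im (z\<^sup>2) ^ (2*k) = 2 ^ (2*k) * (X * Y) ^ k"
      by (simp only: power_mult power_mult_distrib)
    moreover have "Re (z\<^sup>2) = X - Y" by (simp add: X_def Y_def Re_power2)
    ultimately show "Ccoef n k / 2 ^ (2*k) * Re (z\<^sup>2) ^ (2*n - 2*k) * Im (z\<^sup>2) ^ (2*k)
      = Ccoef n k * (X - Y) ^ (2*n - 2*k) * (X * Y) ^ k"
      by simp
  qed
  then have "potential m g n (z\<^sup>2) = - m / (X + Y) - g * ?A"
    by (simp add: potential_def norm_power norm)
  then have "lc_pullback (hamiltonian (potential m g n)) f x
      = (X + Y) * ((norm w)\<^sup>2 / (4 * (X + Y)) / 2 + (- m / (X + Y) - g * ?A) + f)"
    by (simp add: lc_pullback_def hamiltonian_def levi_civita_def Pair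
        norm_power2_levi_civita_momentum norm del: norm_divide)
  also have "\<dots> = (norm w)\<^sup>2 / 8 - m - g * ((X + Y) * ?A) + f * (X + Y)"
  proof -
    have "d * (N / (4 * d) / 2 + (- m / d - g * B) + f) = N / 8 - m - g * (d * B) + f * d"
      if "0 < d" for d N B :: real
      using that by (simp add: field_simps)
    from this [OF pos] show ?thesis .
  qed
  also have "\<dots> = (norm w)\<^sup>2 / 8 - m - g * (X ^ (2*n + 1) + Y ^ (2*n + 1)) + f * (X + Y)"
    by (simp only: Ccoef_separation)
  also have "\<dots> = planar_hamiltonian f g n (proj1 x) + planar_hamiltonian f g n (proj2 x) - m"
    by (simp add: Pair proj1_def proj2_def planar_hamiltonian_well well_def cmod_power2
        X_def [symmetric] Y_def [symmetric] algebra_simps)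
  finally show ?thesis .
qed

text \<open>The limit that defines the regularization at a collision is therefore unique.\<close>

lemma collision_islimpt:
  fixes x :: "complex \<times> complex"
  shows "x islimpt {y. fst y \<noteq> 0}"
  unfolding islimpt_approachable
proof (intro allI impI)
  fix e :: real assume "0 < e"
  show "\<exists>x'\<in>{y. fst y \<noteq> 0}. x' \<noteq> x \<and> dist x' x < e"
  proof (cases "fst x = 0")
    case True
    have "dist (of_real (e / 2), snd x) x < e"
      using True \<open>0 < e\<close> by (cases x) (simp add: dist_Pair_Pair dist_norm)
    then show ?thesis
      using True \<open>0 < e\<close> by (intro bexI [of _ "(of_real (e / 2), snd x)"]) (cases x; auto)+
  next
    case False
    have "dist (fst x, snd x + of_real (e / 2)) x < e"
      using \<open>0 < e\<close> by (cases x) (simp add: dist_Pair_Pair dist_norm)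
    moreover have "(fst x, snd x + of_real (e / 2)) \<noteq> x" using \<open>0 < e\<close> by (cases x) auto
    ultimately show ?thesis
      using False by (intro bexI [of _ "(fst x, snd x + of_real (e / 2))"]) auto
  qed
qed

lemma lc_regularization_separated:
  "lc_regularization (hamiltonian (potential m g n)) f x + m
    = planar_hamiltonian f g n (proj1 x) + planar_hamiltonian f g n (proj2 x)"
proof (cases "fst x = 0")
  case True
  let ?k = "\<lambda>x. planar_hamiltonian f g n (proj1 x) + planar_hamiltonian f g n (proj2 x) - m"
  have "continuous_on UNIV ?k"
    by (intro continuous_intros linear_continuous_on linear_proj1 linear_proj2)
  then have "(?k \<longlongrightarrow> ?k x) (at x within UNIV)"
    unfolding continuous_on_def by blast
  then have "(?k \<longlongrightarrow> ?k x) (at x within {y. fst y \<noteq> 0})"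
    by (rule tendsto_within_subset) simp
  moreover have "\<forall>\<^sub>F y in at x within {y. fst y \<noteq> 0}.
      ?k y = lc_pullback (hamiltonian (potential m g n)) f y"
    using lc_pullback_separated by (auto simp: eventually_at_filter)
  ultimately have "(lc_pullback (hamiltonian (potential m g n)) f \<longlongrightarrow> ?k x) (at x within {y. fst y \<noteq> 0})"
    by (rule Lim_transform_eventually)
  then have "Lim (at x within {y. fst y \<noteq> 0}) (lc_pullback (hamiltonian (potential m g n)) f) = ?k x"
    by (rule tendsto_Lim [rotated]) (simp add: trivial_limit_within collision_islimpt)
  then show ?thesis using True by (simp add: lc_regularization_def)
next
  case False
  then show ?thesis by (simp add: lc_regularization_def lc_pullback_separated)
qed

section \<open>Energies below the first critical value\<close>

text \<open>In the polynomial part only the summand for \<open>k = 0\<close> contributes: the others vanish to second order on the axis.\<close>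

lemma potential_derivative_on_axis:
  fixes r :: real
  assumes "0 < r" "1 \<le> n"
  shows "(potential m g n has_derivative
    (\<lambda>h. (m / r\<^sup>2 - g * (real (2*n) * r ^ (2*n - 1))) * Re h)) (at (of_real r))"
proof -
  have coeff: "((\<lambda>q. Ccoef n k / 2 ^ (2*k) * Re q ^ (2*n - 2*k) * Im q ^ (2*k)) has_derivative
      (\<lambda>h. if k = 0 then real (2*n) * r ^ (2*n - 1) * Re h else 0)) (at (of_real r))" for k
  proof (cases "k = 0")
    case True
    have C: "Ccoef n 0 = 1" by (simp add: Ccoef.simps)
    have "((\<lambda>q. Re q ^ (2*n)) has_derivative (\<lambda>h. real (2*n) * r ^ (2*n - 1) * Re h)) (at (of_real r))"
      by (rule derivative_eq_intros bounded_linear_imp_has_derivative bounded_linear_Re refl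
          | simp add: mult_ac)+
    then show ?thesis using True by (simp add: C)
  next
    case False
    have "((\<lambda>q. Ccoef n k / 2 ^ (2*k) * Re q ^ (2*n - 2*k) * Im q ^ (2*k)) has_derivative
        (\<lambda>h. Ccoef n k / 2 ^ (2*k) * r ^ (2*n - 2*k) * (real (2*k) * Im h * 0 ^ (2*k - 1))
          + Ccoef n k / 2 ^ (2*k) * (real (2*n - 2*k) * Re h * r ^ (2*n - 2*k - 1)) * 0 ^ (2*k)))
        (at (of_real r))"
      by (rule has_derivative_eq_rhs, (rule derivative_intros bounded_linear_imp_has_derivative
            bounded_linear_Re bounded_linear_Im)+) (simp add: mult_ac fun_eq_iff)
    then show ?thesis using False by (simp add: power_0_left)
  qed
  have norm: "((\<lambda>q :: complex. - m / norm q) has_derivative (\<lambda>h. m / r\<^sup>2 * Re h)) (at (of_real r))"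
  proof -
    have "(norm has_derivative (\<lambda>h. Re h)) (at (of_real r :: complex))"
      using has_derivative_norm [of "of_real r :: complex"] assms
      by (simp add: sgn_eq inner_complex_def)
    then show ?thesis
      using assms by (auto intro!: derivative_eq_intros simp: power2_eq_square divide_simps)
  qed
  have "((\<lambda>q. - m / norm q - g * (\<Sum>k\<le>n. Ccoef n k / 2 ^ (2*k) * Re q ^ (2*n - 2*k) * Im q ^ (2*k)))
      has_derivative (\<lambda>h. m / r\<^sup>2 * Re h
        - g * (\<Sum>k\<le>n. if k = 0 then real (2*n) * r ^ (2*n - 1) * Re h else 0))) (at (of_real r))"
    by (intro has_derivative_diff has_derivative_mult_right has_derivative_sum coeff norm)
  moreover have "(\<Sum>k\<le>n. if k = 0 then real (2*n) * r ^ (2*n - 1) * Re h else 0)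
      = real (2*n) * r ^ (2*n - 1) * Re h" for h
    by simp
  ultimately show ?thesis
    by (simp add: potential_def [abs_def] algebra_simps)
qed

text \<open>The radius \<open>r\<close> is the one at which the potential has a critical point on the positive real axis,
where the two terms of its derivative balance. Its critical value is at least the first one, hence
exceeds \<open>- f\<close>; multiplied by \<open>r\<close>, this inequality says that the well exceeds \<open>m\<close> at \<open>r\<close>.\<close>

lemma well_exceeds_below_first_critical_value:
  assumes "m > 0" "g > 0" "n \<ge> 1" and c: "is_first_critical_value (potential m g n) c" and "- f < c"
  shows "\<exists>r>0. m < well f g n r"
proof -
  define r where "r = root (2*n + 1) (m / (2 * real n * g))"
  have r: "0 < r" using assms by (simp add: r_def)
  have "r ^ (2*n + 1) = m / (2 * real n * g)"
    using assms unfolding r_def by (intro real_root_pow_pos2) auto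
  then have m: "m = 2 * real n * g * r ^ (2*n + 1)"
    using assms by simp
  have "r ^ (2*n + 1) = r ^ (2*n - 1) * r\<^sup>2"
    using assms(3) by (subst power_add [symmetric]) simp
  then have "m / r\<^sup>2 = g * (real (2*n) * r ^ (2*n - 1))"
    using r m by simp
  then have "(potential m g n has_derivative (\<lambda>h. 0)) (at (of_real r))"
    using potential_derivative_on_axis [OF r assms(3), of m g] by simp
  then have "potential m g n (of_real r) \<in> critical_values (potential m g n)"
    unfolding critical_values_def using r by (intro CollectI exI [of _ "of_real r"]) auto
  then have "- f < potential m g n (of_real r)"
    using c \<open>- f < c\<close> by (force simp: is_first_critical_value_def)
  also have "potential m g n (of_real r) = - m / r - g * r ^ (2*n)"
  proof -
    have C: "Ccoef n 0 = 1" by (simp add: Ccoef.simps)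
    have "(\<Sum>k\<le>n. Ccoef n k / 2 ^ (2*k) * r ^ (2*n - 2*k) * 0 ^ (2*k))
        = (\<Sum>k\<le>n. if k = 0 then r ^ (2*n) else 0)"
      by (intro sum.cong refl) (auto simp: C power_0_left)
    then show ?thesis using r by (simp add: potential_def)
  qed
  finally have "(m / r + g * r ^ (2*n)) * r < f * r"
    using r by (intro mult_strict_right_mono) auto
  then have "m < well f g n r"
    using r by (simp add: well_def algebra_simps)
  then show ?thesis using r by blast
qed

text \<open>The peak is the zero of \<open>well'\<close>; the turning point comes from the intermediate value theorem.\<close>

lemma subcritical_well_exists:
  assumes "m > 0" "g > 0" "n \<ge> 1" and r: "0 < r" "m < well f g n r"
  shows "\<exists>\<rho>c \<rho>m. subcritical_well f g \<rho>c n m \<rho>m"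
proof -
  have "0 < g * r ^ (2*n + 1)" using r(1) assms(2) by simp
  then have "0 < f * r" using r(2) assms(1) by (simp add: well_def)
  then have f: "0 < f" using r by (simp add: zero_less_mult_iff)
  define d where "d = (2 * real n + 1) * g"
  define \<rho>c where "\<rho>c = root (2*n) (f / d)"
  have d: "0 < d" using assms(2) by (simp add: d_def add_nonneg_pos)
  have "0 < \<rho>c" using f d assms(3) by (simp add: \<rho>c_def)
  have "\<rho>c ^ (2*n) = f / d"
    using f d assms(3) unfolding \<rho>c_def by (intro real_root_pow_pos2) auto
  then have "well' f g n \<rho>c = f - d * (f / d)" by (simp add: well'_def d_def)
  then have "well' f g n \<rho>c = 0" using d by simp
  then interpret well_with_peak f g \<rho>c n
    using assms \<open>0 < \<rho>c\<close> by unfold_locales auto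
  have peak: "U r \<le> U \<rho>c"
    using U_mono [of r \<rho>c] U_decreasing [of \<rho>c r] r \<open>0 < \<rho>c\<close> by (cases "r \<le> \<rho>c") auto
  have "continuous_on {0..\<rho>c} U"
    using well_derivative by (rule DERIV_continuous_on)
  then obtain \<rho>m where \<rho>m: "0 \<le> \<rho>m" "\<rho>m \<le> \<rho>c" "U \<rho>m = m"
    using IVT' [of U 0 m \<rho>c] U_0 assms(1) r(2) peak \<open>0 < \<rho>c\<close> by auto
  have "\<rho>m \<noteq> 0" "\<rho>m \<noteq> \<rho>c" using \<rho>m U_0 assms(1) r(2) peak by auto
  then have "subcritical_well f g \<rho>c n m \<rho>m"
    using \<rho>m assms(1) by unfold_locales auto
  then show ?thesis by blast
qed

section \<open>The bounded component of the regularized surface\<close>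

context subcritical_well
begin

definition level :: "(complex \<times> complex) set" where
  "level = {x. K (proj1 x) + K (proj2 x) = m}"

text \<open>The bounded component, where both coordinates stay within the turning points. It is a deformed round
three-sphere, parametrized by \<open>chart\<close> below.\<close>

definition sphere3 :: "(complex \<times> complex) set" where
  "sphere3 = {x \<in> level. (Re (fst x))\<^sup>2 \<le> \<rho>m \<and> (Im (fst x))\<^sup>2 \<le> \<rho>m}"

lemma U_le_K: "U ((fst y)\<^sup>2) \<le> K y"
  by (simp add: K_eq)

lemma sphere3I:
  assumes x: "x \<in> level" and le: "(Re (fst x))\<^sup>2 \<le> \<rho>c" "(Im (fst x))\<^sup>2 \<le> \<rho>c"
  shows "x \<in> sphere3"
proof -
  have "U ((Re (fst x))\<^sup>2) + U ((Im (fst x))\<^sup>2) \<le> m"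
    using x U_le_K [of "proj1 x"] U_le_K [of "proj2 x"] by (simp add: level_def)
  then have "U ((Re (fst x))\<^sup>2) \<le> m" "U ((Im (fst x))\<^sup>2) \<le> m"
    using U_nonneg [OF _ le(1)] U_nonneg [OF _ le(2)] by auto
  then show ?thesis
    using x le le_\<rho>m_iff by (simp add: sphere3_def)
qed

text \<open>The part of the level with both squares at most \<open>\<rho>c\<close> avoids the value \<open>\<rho>c\<close>, since the energy of
the peak exceeds \<open>m\<close> and the other summand is nonnegative there. So one set is cut out both by strict
and by weak inequalities.\<close>

lemma sphere3_clopen:
  "sphere3 = level \<inter> {x. (Re (fst x))\<^sup>2 < \<rho>c \<and> (Im (fst x))\<^sup>2 < \<rho>c}"
  "sphere3 = level \<inter> {x. (Re (fst x))\<^sup>2 \<le> \<rho>c \<and> (Im (fst x))\<^sup>2 \<le> \<rho>c}"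
  using sphere3I \<rho>m by (auto simp: sphere3_def)

text \<open>The odd function with \<open>U ((h v)\<^sup>2) = v\<^sup>2\<close>, which turns the well into a harmonic oscillator. Applied
to both coordinates it maps a round sphere onto the bounded component.\<close>

definition h :: "real \<Rightarrow> real" where
  "h v = v * q (v\<^sup>2)"

lemma h_square: "v\<^sup>2 \<le> m \<Longrightarrow> (h v)\<^sup>2 = R (v\<^sup>2)"
  using R_eq [of "v\<^sup>2"] by (simp add: h_def power_mult_distrib)

lemma h_surj:
  assumes "s\<^sup>2 \<le> \<rho>m"
  obtains v where "v\<^sup>2 = U (s\<^sup>2)" "h v = s"
proof -
  define y where "y = U (s\<^sup>2)"
  have y: "y \<in> {0..m}" "R y = s\<^sup>2"
    using assms le_\<rho>m_iff [of "s\<^sup>2"] U_nonneg [of "s\<^sup>2"] \<rho>m R_simps(1) [of "s\<^sup>2"] by (auto simp: y_def)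
  have "(s / q y)\<^sup>2 = y"
    using R_eq [OF y(1)] q_pos [OF y(1)] y(2) by (simp add: power_divide)
  moreover from this have "h (s / q y) = s"
    using q_pos [OF y(1)] by (simp add: h_def)
  ultimately show ?thesis using that y_def by blast
qed

lemma continuous_on_h: "continuous_on {v. v\<^sup>2 \<le> m} h"
  unfolding h_def [abs_def]
  by (intro continuous_intros continuous_on_compose2 [OF smooth_on_imp_continuous_on [OF smooth_on_q]])
     auto

text \<open>The points of the round sphere \<open>(norm a)\<^sup>2 + (norm b)\<^sup>2 = m\<close> are written with \<open>a\<close> in polar
coordinates. Its parts with \<open>a\<close> arbitrary and with \<open>a \<noteq> 0\<close> are then images of the products of a line
with a closed and with an open disc, so that both are connected.\<close>

definition chart_base :: "real \<times> complex \<Rightarrow> complex" where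
  "chart_base = (\<lambda>(\<theta>, b). cis \<theta> * of_real (sqrt (m - (norm b)\<^sup>2)))"

definition chart :: "real \<times> complex \<Rightarrow> complex \<times> complex" where
  "chart y = (Complex (h (Re (chart_base y))) (h (Im (chart_base y))), of_real (sqrt 8) * snd y)"

lemma chart_base_norm:
  assumes "norm (snd y) \<le> sqrt m"
  shows "(Re (chart_base y))\<^sup>2 + (Im (chart_base y))\<^sup>2 + (norm (snd y))\<^sup>2 = m"
proof -
  have "(norm (snd y))\<^sup>2 \<le> m"
    using power_mono [OF assms, of 2] m by simp
  then have "(norm (chart_base y))\<^sup>2 = m - (norm (snd y))\<^sup>2"
    by (cases y) (simp add: chart_base_def norm_mult)
  then show ?thesis by (simp add: cmod_power2)
qed

lemma chart_base_le:
  assumes "norm (snd y) \<le> sqrt m"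
  shows "(Re (chart_base y))\<^sup>2 \<le> m" "(Im (chart_base y))\<^sup>2 \<le> m"
  using chart_base_norm [OF assms] zero_le_power2 [of "Re (chart_base y)"]
    zero_le_power2 [of "Im (chart_base y)"] zero_le_power2 [of "norm (snd y)"]
  by linarith+

lemma chart_in_sphere3:
  assumes "norm (snd y) \<le> sqrt m"
  shows "chart y \<in> sphere3"
proof -
  note le = chart_base_le [OF assms]
  have w: "(Re (snd (chart y)))\<^sup>2 / 8 + (Im (snd (chart y)))\<^sup>2 / 8 = (norm (snd y))\<^sup>2"
    by (simp add: chart_def power_mult_distrib cmod_power2)
  have "U ((h v)\<^sup>2) = v\<^sup>2" if "v\<^sup>2 \<le> m" for v
    using R_simps(3) [of "v\<^sup>2"] that by (simp add: h_square)
  then have "chart y \<in> level"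
    using chart_base_norm [OF assms] w le by (simp add: level_def K_eq) (simp add: chart_def)
  moreover have "(h v)\<^sup>2 \<le> \<rho>m" if "v\<^sup>2 \<le> m" for v
    using R_range [of "v\<^sup>2"] that by (simp add: h_square)
  ultimately show ?thesis using le by (simp add: sphere3_def chart_def)
qed

lemma sphere3_chart:
  assumes x: "x \<in> sphere3"
  obtains y where "x = chart y" "norm (snd y) \<le> sqrt m" "fst x \<noteq> 0 \<Longrightarrow> norm (snd y) < sqrt m"
proof -
  obtain z w where zw: "x = (z, w)" by fastforce
  obtain v1 where v1: "v1\<^sup>2 = U ((Re z)\<^sup>2)" "h v1 = Re z"
    by (rule h_surj [of "Re z"]) (use x zw in \<open>auto simp: sphere3_def\<close>)
  obtain v2 where v2: "v2\<^sup>2 = U ((Im z)\<^sup>2)" "h v2 = Im z"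
    by (rule h_surj [of "Im z"]) (use x zw in \<open>auto simp: sphere3_def\<close>)
  define a where "a = Complex v1 v2"
  define b where "b = w / of_real (sqrt 8)"
  have w: "w = of_real (sqrt 8) * b" by (simp add: b_def)
  have "(norm b)\<^sup>2 = (norm w)\<^sup>2 / 8" by (simp add: b_def norm_divide power_divide)
  then have ab: "(norm a)\<^sup>2 + (norm b)\<^sup>2 = m"
    using x v1(1) v2(1) by (simp add: a_def cmod_power2 zw sphere3_def level_def K_eq)
  then have na: "norm a = sqrt (m - (norm b)\<^sup>2)"
    by (metis add_diff_cancel_right' norm_ge_zero real_sqrt_unique)
  have "a = chart_base (Arg a, b)"
    using rcis_cmod_Arg [of a] by (simp add: chart_base_def rcis_def na [symmetric] mult.commute)
  then have "x = chart (Arg a, b)"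
    using v1(2) v2(2) w by (simp add: chart_def zw a_def complex_eq_iff del: of_real_mult)
  moreover have "norm b \<le> sqrt m"
    using ab by (intro real_le_rsqrt) (metis le_add_same_cancel2 zero_le_power2)
  moreover have "norm b < sqrt m" if "fst x \<noteq> 0"
  proof -
    have "a \<noteq> 0" using that v1(2) v2(2) by (auto simp: zw a_def complex_eq_iff h_def)
    then have "(norm b)\<^sup>2 < m" using ab by (smt (verit) zero_less_norm_iff zero_less_power)
    then show ?thesis by (simp add: real_less_rsqrt)
  qed
  ultimately show ?thesis using that [of "(Arg a, b)"] by simp
qed

lemma sphere3_eq_image: "sphere3 = chart ` (UNIV \<times> cball 0 (sqrt m))"
proof (intro equalityI subsetI)
  fix x assume "x \<in> sphere3"
  then obtain y where "x = chart y" "norm (snd y) \<le> sqrt m" by (rule sphere3_chart)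
  then show "x \<in> chart ` (UNIV \<times> cball 0 (sqrt m))"
    by (intro image_eqI [of _ _ y]) (auto simp: mem_Times_iff)
next
  fix x assume "x \<in> chart ` (UNIV \<times> cball 0 (sqrt m))"
  then obtain y where "x = chart y" "norm (snd y) \<le> sqrt m" by auto
  then show "x \<in> sphere3" using chart_in_sphere3 by simp
qed

lemma regular_sphere3_eq_image: "{x \<in> sphere3. fst x \<noteq> 0} = chart ` (UNIV \<times> ball 0 (sqrt m))"
proof (intro equalityI subsetI)
  fix x assume "x \<in> {x \<in> sphere3. fst x \<noteq> 0}"
  then have x: "x \<in> sphere3" "fst x \<noteq> 0" by auto
  obtain y where "x = chart y" "norm (snd y) < sqrt m"
    using sphere3_chart [OF x(1)] x(2) by metis
  then show "x \<in> chart ` (UNIV \<times> ball 0 (sqrt m))"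
    by (intro image_eqI [of _ _ y]) (auto simp: mem_Times_iff)
next
  fix x assume "x \<in> chart ` (UNIV \<times> ball 0 (sqrt m))"
  then obtain y where y: "x = chart y" "norm (snd y) < sqrt m" by auto
  then have "norm (snd y) \<le> sqrt m" by simp
  note le = chart_base_le [OF this] and base = chart_base_norm [OF this] and S = chart_in_sphere3 [OF this]
  have "(norm (snd y))\<^sup>2 < m"
    using power_strict_mono [OF y(2), of 2] m by simp
  then have "Re (chart_base y) \<noteq> 0 \<or> Im (chart_base y) \<noteq> 0" using base by auto
  moreover have "h v \<noteq> 0" if "v \<noteq> 0" "v\<^sup>2 \<le> m" for v
    using q_pos [of "v\<^sup>2"] that by (simp add: h_def)
  ultimately show "x \<in> {x \<in> sphere3. fst x \<noteq> 0}"
    using le S y(1) by (auto simp: chart_def complex_eq_iff)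
qed

lemma continuous_on_chart: "continuous_on (UNIV \<times> cball 0 (sqrt m)) chart"
proof -
  have base: "continuous_on T chart_base" for T
    unfolding chart_base_def case_prod_beta' by (intro continuous_intros)
  show ?thesis
    unfolding chart_def [abs_def] complex_eq
    by (intro continuous_intros continuous_on_compose2 [OF continuous_on_h] base)
       (use chart_base_le in auto)
qed

lemma connected_sphere3: "connected sphere3"
  unfolding sphere3_eq_image
  by (intro connected_continuous_image continuous_on_chart connected_Times) auto

lemma connected_regular_sphere3: "connected {x \<in> sphere3. fst x \<noteq> 0}"
  unfolding regular_sphere3_eq_image
  by (intro connected_continuous_image continuous_on_subset [OF continuous_on_chart] connected_Times) auto

lemma regular_sphere3_nonempty: "{x \<in> sphere3. fst x \<noteq> 0} \<noteq> {}"
  unfolding regular_sphere3_eq_image using m by auto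

lemma sphere3_component: "sphere3 \<in> components level"
proof (rule components_if_clopen)
  show "sphere3 = level \<inter> {x. (Re (fst x))\<^sup>2 < \<rho>c \<and> (Im (fst x))\<^sup>2 < \<rho>c}"
    by (rule sphere3_clopen)
  show "open {x :: complex \<times> complex. (Re (fst x))\<^sup>2 < \<rho>c \<and> (Im (fst x))\<^sup>2 < \<rho>c}"
    by (intro open_Collect_conj open_Collect_less continuous_intros)
  show "sphere3 = level \<inter> {x. (Re (fst x))\<^sup>2 \<le> \<rho>c \<and> (Im (fst x))\<^sup>2 \<le> \<rho>c}"
    by (rule sphere3_clopen)
  show "closed {x :: complex \<times> complex. (Re (fst x))\<^sup>2 \<le> \<rho>c \<and> (Im (fst x))\<^sup>2 \<le> \<rho>c}"
    by (intro closed_Collect_conj closed_Collect_le continuous_intros)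
qed (use connected_sphere3 regular_sphere3_nonempty in auto)

definition sublevel :: "(complex \<times> complex) set" where
  "sublevel = {x. (Re (fst x))\<^sup>2 < \<rho>c \<and> (Im (fst x))\<^sup>2 < \<rho>c \<and> K (proj1 x) + K (proj2 x) < m}"

lemma bounded_closed_sublevel:
  "bounded {x. (Re (fst x))\<^sup>2 \<le> \<rho>c \<and> (Im (fst x))\<^sup>2 \<le> \<rho>c \<and> K (proj1 x) + K (proj2 x) \<le> m}"
    (is "bounded ?B")
proof -
  have "?B \<subseteq> cball 0 (sqrt (2 * \<rho>c)) \<times> cball 0 (sqrt (8 * m))"
  proof
    fix x assume x: "x \<in> ?B"
    have "0 \<le> U ((Re (fst x))\<^sup>2)" "0 \<le> U ((Im (fst x))\<^sup>2)"
      using x by (auto intro: U_nonneg)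
    then have "(norm (snd x))\<^sup>2 \<le> 8 * m" "(norm (fst x))\<^sup>2 \<le> 2 * \<rho>c"
      using x by (auto simp: K_eq cmod_power2)
    then show "x \<in> cball 0 (sqrt (2 * \<rho>c)) \<times> cball 0 (sqrt (8 * m))"
      by (cases x) (simp add: real_le_rsqrt)
  qed
  then show ?thesis by (rule bounded_subset [rotated]) (intro bounded_Times bounded_cball)
qed

lemma bounded_sphere3: "bounded sphere3"
  by (rule bounded_subset [OF bounded_closed_sublevel]) (use sphere3_clopen(2) in \<open>auto simp: level_def\<close>)

lemma origin_inside_sphere3: "0 \<in> inside sphere3"
proof -
  have cont: "continuous_on T (\<lambda>x. K (proj1 x) + K (proj2 x))" for T
    by (intro continuous_intros linear_continuous_on linear_proj1 linear_proj2)
  have "sublevel \<subseteq> inside sphere3"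
  proof (rule subset_inside_if_frontier_subset)
    show "bounded sublevel"
      by (rule bounded_subset [OF bounded_closed_sublevel]) (auto simp: sublevel_def)
    show "sublevel \<inter> sphere3 = {}" by (auto simp: sublevel_def sphere3_def level_def)
    have "open sublevel"
      unfolding sublevel_def by (intro open_Collect_conj open_Collect_less continuous_intros cont)
    moreover have "closed {x. (Re (fst x))\<^sup>2 \<le> \<rho>c \<and> (Im (fst x))\<^sup>2 \<le> \<rho>c \<and> K (proj1 x) + K (proj2 x) \<le> m}"
      by (intro closed_Collect_conj closed_Collect_le continuous_intros cont)
    then have "closure sublevel
        \<subseteq> {x. (Re (fst x))\<^sup>2 \<le> \<rho>c \<and> (Im (fst x))\<^sup>2 \<le> \<rho>c \<and> K (proj1 x) + K (proj2 x) \<le> m}"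
      by (rule closure_minimal [rotated]) (auto simp: sublevel_def)
    ultimately have frontier: "x \<notin> sublevel \<and> (Re (fst x))\<^sup>2 \<le> \<rho>c \<and> (Im (fst x))\<^sup>2 \<le> \<rho>c
        \<and> K (proj1 x) + K (proj2 x) \<le> m" if "x \<in> frontier sublevel" for x
      using that by (auto simp: frontier_def interior_open)
    show "frontier sublevel \<subseteq> sphere3"
    proof
      fix x assume "x \<in> frontier sublevel"
      note x = frontier [OF this]
      then have nonneg: "0 \<le> U ((Re (fst x))\<^sup>2)" "0 \<le> U ((Im (fst x))\<^sup>2)" by (auto intro: U_nonneg)
      have "K (proj1 x) + K (proj2 x) = m"
      proof (rule ccontr)
        assume "K (proj1 x) + K (proj2 x) \<noteq> m"
        then have less: "K (proj1 x) + K (proj2 x) < m" using x by simp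
        then have "(Re (fst x))\<^sup>2 = \<rho>c \<or> (Im (fst x))\<^sup>2 = \<rho>c" using x by (auto simp: sublevel_def)
        then have "U \<rho>c \<le> U ((Re (fst x))\<^sup>2) + U ((Im (fst x))\<^sup>2)" using nonneg by auto
        also have "\<dots> \<le> K (proj1 x) + K (proj2 x)"
          using U_le_K [of "proj1 x"] U_le_K [of "proj2 x"] by simp
        finally show False using less m_less_U_\<rho>c by simp
      qed
      then show "x \<in> sphere3" using x by (intro sphere3I) (auto simp: level_def)
    qed
  qed
  moreover have "0 \<in> sublevel"
    using m \<rho>c by (simp add: sublevel_def K_eq U_0)
  ultimately show ?thesis by blast
qed

text \<open>Beyond the peak the well is decreasing, so that the position can be moved to infinity along the level
while the kinetic term grows to compensate.\<close>

lemma unbounded_planar_branch: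
  assumes "\<rho>c < (fst y)\<^sup>2"
  obtains L where "connected L" "y \<in> L" "\<not> bounded L" "\<And>y'. y' \<in> L \<Longrightarrow> K y' = K y"
proof -
  obtain s t where y: "y = (s, t)" by fastforce
  \<comment> \<open>Signs that are nonzero also for t = 0, so that the branch starts at y itself.\<close>
  define \<epsilon> \<delta> :: real where "\<epsilon> = (if s < 0 then -1 else 1)" and "\<delta> = (if t < 0 then -1 else 1)"
  have sgn: "\<epsilon>\<^sup>2 = 1" "\<epsilon> * \<bar>s\<bar> = s" "\<delta>\<^sup>2 = 1" "\<delta> * \<bar>t\<bar> = t" "\<bar>\<epsilon>\<bar> = 1"
    by (auto simp: \<epsilon>_def \<delta>_def)
  define \<gamma> where "\<gamma> = (\<lambda>\<tau>. (\<epsilon> * \<tau>, \<delta> * sqrt (8 * (K y - U (\<tau>\<^sup>2)))))"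
  have K: "K (\<gamma> \<tau>) = K y" if "\<bar>s\<bar> \<le> \<tau>" for \<tau>
  proof -
    have "s\<^sup>2 \<le> \<tau>\<^sup>2" using that power_mono [of "\<bar>s\<bar>" \<tau> 2] by simp
    then have "U (\<tau>\<^sup>2) \<le> U (s\<^sup>2)"
      using U_decreasing [of "s\<^sup>2" "\<tau>\<^sup>2"] assms y by (cases "s\<^sup>2 = \<tau>\<^sup>2") auto
    also have "\<dots> \<le> K y" by (simp add: K_eq y)
    finally show ?thesis
      unfolding K_eq [of "\<gamma> \<tau>"] by (simp add: \<gamma>_def power_mult_distrib sgn diff_divide_distrib)
  qed
  have "connected (\<gamma> ` {\<bar>s\<bar>..})"
    unfolding \<gamma>_def by (intro connected_continuous_image continuous_intros) auto
  moreover have "y \<in> \<gamma> ` {\<bar>s\<bar>..}"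
    by (rule image_eqI [of _ _ "\<bar>s\<bar>"]) (auto simp: \<gamma>_def sgn y K_eq real_sqrt_mult)
  moreover have "\<not> bounded (\<gamma> ` {\<bar>s\<bar>..})"
  proof
    assume "bounded (\<gamma> ` {\<bar>s\<bar>..})"
    then obtain B where B: "\<And>\<tau>. \<bar>s\<bar> \<le> \<tau> \<Longrightarrow> norm (\<gamma> \<tau>) \<le> B" unfolding bounded_iff by auto
    define \<tau> where "\<tau> = max \<bar>s\<bar> (B + 1)"
    have "norm (\<epsilon> * \<tau>) \<le> norm (\<gamma> \<tau>)"
      unfolding \<gamma>_def by (rule norm_fst_le)
    then have "\<bar>\<tau>\<bar> \<le> norm (\<gamma> \<tau>)" by (simp add: abs_mult sgn)
    moreover have "norm (\<gamma> \<tau>) \<le> B" by (rule B) (simp add: \<tau>_def)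
    ultimately show False by (simp add: \<tau>_def)
  qed
  moreover have "K y' = K y" if "y' \<in> \<gamma> ` {\<bar>s\<bar>..}" for y'
    using that K by auto
  ultimately show ?thesis by (rule that)
qed

text \<open>At a point outside of the bounded component one coordinate lies beyond the peak. The planar branch
through it, with the other coordinate and its momentum kept constant, stays in the level.\<close>

lemma other_components_unbounded:
  assumes S: "S \<in> components level" "S \<noteq> sphere3"
  shows "\<not> bounded S"
proof -
  obtain x where x: "x \<in> S" using in_components_nonempty [OF S(1)] by blast
  then have xl: "x \<in> level" using in_components_subset [OF S(1)] by blast
  have "x \<notin> sphere3"
    using components_nonoverlap [OF S(1) sphere3_component] x S(2) by blast
  then consider "\<rho>c < (fst (proj1 x))\<^sup>2" | "\<rho>c < (fst (proj2 x))\<^sup>2"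
    using sphere3I [OF xl] by fastforce
  then show ?thesis
  proof cases
    case 1
    then obtain L where L: "connected L" "proj1 x \<in> L" "\<not> bounded L" "\<And>y. y \<in> L \<Longrightarrow> K y = K (proj1 x)"
      using unbounded_planar_branch by blast
    define \<iota> where "\<iota> = (\<lambda>y. (Complex (fst y) (Im (fst x)), Complex (snd y) (Im (snd x))))"
    have \<iota>: "proj1 (\<iota> y) = y" "proj2 (\<iota> y) = proj2 x" for y
      by (auto simp: \<iota>_def proj1_def proj2_def case_prod_beta')
    have "connected (\<iota> ` L)"
      unfolding \<iota>_def complex_eq by (intro connected_continuous_image continuous_intros L)
    moreover have "\<iota> ` L \<subseteq> level" using xl L(4) by (auto simp: level_def \<iota>)
    moreover have "\<iota> (proj1 x) = x" by (cases x) (simp add: \<iota>_def)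
    then have "x \<in> \<iota> ` L" using L(2) by (metis imageI)
    ultimately have "\<iota> ` L \<subseteq> S" using components_maximal [OF S(1)] x by blast
    moreover have "L = proj1 ` \<iota> ` L" using \<iota>(1) by (simp add: image_image)
    ultimately have "L \<subseteq> proj1 ` S" by (metis image_mono)
    then show ?thesis using L(3) bounded_linear_image [OF _ linear_proj1] bounded_subset by blast
  next
    case 2
    then obtain L where L: "connected L" "proj2 x \<in> L" "\<not> bounded L" "\<And>y. y \<in> L \<Longrightarrow> K y = K (proj2 x)"
      using unbounded_planar_branch by blast
    define \<iota> where "\<iota> = (\<lambda>y. (Complex (Re (fst x)) (fst y), Complex (Re (snd x)) (snd y)))"
    have \<iota>: "proj2 (\<iota> y) = y" "proj1 (\<iota> y) = proj1 x" for y
      by (auto simp: \<iota>_def proj1_def proj2_def case_prod_beta')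
    have "connected (\<iota> ` L)"
      unfolding \<iota>_def complex_eq by (intro connected_continuous_image continuous_intros L)
    moreover have "\<iota> ` L \<subseteq> level" using xl L(4) by (auto simp: level_def \<iota>)
    moreover have "\<iota> (proj2 x) = x" by (cases x) (simp add: \<iota>_def)
    then have "x \<in> \<iota> ` L" using L(2) by (metis imageI)
    ultimately have "\<iota> ` L \<subseteq> S" using components_maximal [OF S(1)] x by blast
    moreover have "L = proj2 ` \<iota> ` L" using \<iota>(1) by (simp add: image_image)
    ultimately have "L \<subseteq> proj2 ` S" by (metis image_mono)
    then show ?thesis using L(3) bounded_linear_image [OF _ linear_proj2] bounded_subset by blast
  qed
qed

section \<open>The image of the bounded component under the Levi-Civita map\<close>

abbreviation "H \<equiv> hamiltonian (potential m g n)"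

lemma regularized_surface_eq_level: "regularized_surface H f = level"
proof -
  have "lc_regularization H f x = 0 \<longleftrightarrow> K (proj1 x) + K (proj2 x) = m" for x
    using lc_regularization_separated [of m g n f x] by linarith
  then show ?thesis by (simp add: regularized_surface_def level_def)
qed

lemma levi_civita_energy_surface:
  assumes "fst x \<noteq> 0"
  shows "levi_civita x \<in> energy_surface H f \<longleftrightarrow> x \<in> level"
proof -
  have "fst (levi_civita x) \<noteq> 0" using assms by (cases x) (simp add: levi_civita_def)
  moreover have "H (levi_civita x) = - f \<longleftrightarrow> lc_pullback H f x = 0"
    using assms by (auto simp: lc_pullback_def)
  ultimately show ?thesis
    using lc_pullback_separated [OF assms, of m g n f] by (auto simp: energy_surface_def level_def)
qed

lemma levi_civita_surj:
  assumes "fst y \<noteq> 0"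
  obtains x where "levi_civita x = y" "fst x \<noteq> 0"
proof
  let ?z = "csqrt (fst y)"
  show "levi_civita (?z, 2 * cnj ?z * snd y) = y" "fst (?z, 2 * cnj ?z * snd y) \<noteq> 0"
    using assms by (auto simp: levi_civita_def prod_eq_iff)
qed

text \<open>This expresses the size of the larger coordinate of \<open>z\<close> through \<open>q = z\<^sup>2\<close>. Hence the image of the
bounded component can be cut out of the energy surface by an inequality for \<open>q\<close>.\<close>

lemma levi_civita_size:
  "norm (fst (levi_civita x)) + \<bar>Re (fst (levi_civita x))\<bar>
    = 2 * max ((Re (fst x))\<^sup>2) ((Im (fst x))\<^sup>2)"
  by (cases x) (simp add: levi_civita_def norm_power cmod_power2 Re_power2 max_def abs_if)

lemma levi_civita_sphere3_clopen:
  "levi_civita ` {x \<in> sphere3. fst x \<noteq> 0}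
    = energy_surface H f \<inter> {y. norm (fst y) + \<bar>Re (fst y)\<bar> < 2 * \<rho>c}" (is "?E = ?U")
  "levi_civita ` {x \<in> sphere3. fst x \<noteq> 0}
    = energy_surface H f \<inter> {y. norm (fst y) + \<bar>Re (fst y)\<bar> \<le> 2 * \<rho>c}" (is "_ = ?F")
proof -
  have "?E \<subseteq> ?U"
    using levi_civita_energy_surface levi_civita_size sphere3_clopen(1) by auto
  moreover have "?U \<subseteq> ?F" by auto
  moreover have "?F \<subseteq> ?E"
  proof
    fix y assume y: "y \<in> ?F"
    then have "fst y \<noteq> 0" by (auto simp: energy_surface_def)
    then obtain x where x: "levi_civita x = y" "fst x \<noteq> 0" using levi_civita_surj by metis
    have "x \<in> level" using levi_civita_energy_surface [OF x(2)] x(1) y by blast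
    moreover have "max ((Re (fst x))\<^sup>2) ((Im (fst x))\<^sup>2) \<le> \<rho>c"
      using levi_civita_size [of x] x(1) y by simp
    ultimately have "x \<in> sphere3" by (intro sphere3I) auto
    then show "y \<in> ?E" using x by blast
  qed
  ultimately show "?E = ?U" "?E = ?F" by blast+
qed

lemma levi_civita_sphere3_component:
  "levi_civita ` {x \<in> sphere3. fst x \<noteq> 0} \<in> components (energy_surface H f)"
proof (rule components_if_clopen [OF _ _ levi_civita_sphere3_clopen(1) _ levi_civita_sphere3_clopen(2)])
  show "levi_civita ` {x \<in> sphere3. fst x \<noteq> 0} \<noteq> {}" using regular_sphere3_nonempty by blast
  have "continuous_on {x. fst x \<noteq> 0} levi_civita"
    unfolding levi_civita_def case_prod_beta' by (intro continuous_intros) auto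
  then show "connected (levi_civita ` {x \<in> sphere3. fst x \<noteq> 0})"
    by (intro connected_continuous_image connected_regular_sphere3) (auto elim: continuous_on_subset)
  show "open {y :: complex \<times> complex. norm (fst y) + \<bar>Re (fst y)\<bar> < 2 * \<rho>c}"
    by (intro open_Collect_less continuous_intros)
  show "closed {y :: complex \<times> complex. norm (fst y) + \<bar>Re (fst y)\<bar> \<le> 2 * \<rho>c}"
    by (intro closed_Collect_le continuous_intros)
qed

lemma bounded_regularized_component_iff: "bounded_regularized_component H f S \<longleftrightarrow> S = sphere3"
proof
  assume "bounded_regularized_component H f S"
  then show "S = sphere3"
    using other_components_unbounded
    by (auto simp: bounded_regularized_component_def regularized_surface_eq_level)
next
  assume S: "S = sphere3"
  have "bounded (fst ` levi_civita ` {x \<in> sphere3. fst x \<noteq> 0})"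
    unfolding bounded_iff
  proof (intro exI ballI)
    fix q assume "q \<in> fst ` levi_civita ` {x \<in> sphere3. fst x \<noteq> 0}"
    then have "norm q + \<bar>Re q\<bar> \<le> 2 * \<rho>c" unfolding levi_civita_sphere3_clopen(2) by auto
    then show "norm q \<le> 2 * \<rho>c" using abs_ge_zero [of "Re q"] by linarith
  qed
  then show "bounded_regularized_component H f S"
    using S sphere3_component bounded_sphere3 levi_civita_sphere3_component
    by (auto simp: bounded_regularized_component_def regularized_surface_eq_level)
qed

text \<open>A point of \<open>P\<close> lifts by putting the missing energy into the momentum of the other coordinate.\<close>

lemma projections_sphere3: "proj1 ` sphere3 = P" "proj2 ` sphere3 = P"
proof -
  have "K (proj1 x) \<le> m \<and> K (proj2 x) \<le> m" if "x \<in> sphere3" for x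
  proof -
    have le: "(Re (fst x))\<^sup>2 \<le> \<rho>c" "(Im (fst x))\<^sup>2 \<le> \<rho>c" using that sphere3_clopen(2) by auto
    have "0 \<le> K (proj1 x)" "0 \<le> K (proj2 x)"
      unfolding K_eq using U_nonneg [OF _ le(1)] U_nonneg [OF _ le(2)] by (auto intro!: add_nonneg_nonneg)
    moreover have "K (proj1 x) + K (proj2 x) = m" using that by (simp add: sphere3_def level_def)
    ultimately show ?thesis by linarith
  qed
  then have "proj1 ` sphere3 \<subseteq> P" "proj2 ` sphere3 \<subseteq> P" by (auto simp: P_def sphere3_def)
  moreover have "y \<in> proj1 ` sphere3 \<and> y \<in> proj2 ` sphere3" if y: "y \<in> P" for y
  proof -
    define t where "t = sqrt (8 * (m - K y))"
    have t: "K (0, t) = m - K y" 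
      unfolding K_eq [of "(0, t)"] using y by (simp add: t_def U_0 P_def diff_divide_distrib)
    let ?x1 = "(Complex (fst y) 0, Complex (snd y) t)" and ?x2 = "(Complex 0 (fst y), Complex t (snd y))"
    have p: "proj1 ?x1 = y" "proj2 ?x1 = (0, t)" "proj1 ?x2 = (0, t)" "proj2 ?x2 = y"
      by (simp_all add: proj1_def proj2_def)
    have "?x1 \<in> sphere3" "?x2 \<in> sphere3"
      using y t \<rho>m by (simp_all add: sphere3_def level_def p P_def)
    then show ?thesis using p by (metis imageI)
  qed
  ultimately show "proj1 ` sphere3 = P" "proj2 ` sphere3 = P" by blast+
qed

lemma moment_curve_sphere3: "moment_curve K K m sphere3 = (\<lambda>a. (I a, I (m - a))) ` {0..m}"
  unfolding moment_curve_def projections_sphere3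
  by (intro image_cong) (auto simp: action_eq_I)

lemma sphere3_bounds_concave_toric_domain: "bounds_concave_toric_domain K K m sphere3"
  unfolding bounds_concave_toric_domain_def moment_curve_sphere3
  using origin_inside_sphere3 convex_graph_I by blast

end

theorem theorem3:
  fixes m g f c :: real and n :: nat
    and V :: "complex \<Rightarrow> real" and H :: "complex \<times> complex \<Rightarrow> real"
    and k :: "real \<times> real \<Rightarrow> real"
  defines "V \<equiv> potential m g n"
    and "H \<equiv> hamiltonian V"
    and "k \<equiv> planar_hamiltonian f g n"
  assumes "m > 0" and "g > 0" and "n \<ge> 1"
    and "\<And>j. j < n \<Longrightarrow> Gcoef n j > 0"
    and "is_first_critical_value V c" and "- f < c"
  shows "(\<forall>x. lc_regularization H f x + m = k (proj1 x) + k (proj2 x)) \<and>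
    (\<exists>!S. bounded_regularized_component H f S) \<and>
    (\<forall>S. bounded_regularized_component H f S \<longrightarrow> bounds_concave_toric_domain k k m S)"
proof -
  obtain r where "0 < r" "m < well f g n r"
    using well_exceeds_below_first_critical_value [of m g n c f] assms by blast
  then obtain \<rho>c \<rho>m where "subcritical_well f g \<rho>c n m \<rho>m"
    using subcritical_well_exists assms(4-6) by blast
  then interpret subcritical_well f g \<rho>c n m \<rho>m .
  show ?thesis
    unfolding V_def H_def k_def bounded_regularized_component_iff
    using lc_regularization_separated sphere3_bounds_concave_toric_domain by auto
qed

end
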